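(* Let $n \ge 2$. The isometry group of the metric space $(B_T^n, d)$ is isomorphic to the hyperoctahedral group $H_n$.
   Context: For $v \in \mathbb{R}^n$ let $\|v\|_T = \sum_{i=1}^n |v_i|$, and let $B_T^n = \{x \in \mathbb{R}^n : \|x\|_T < 1\}$. $\Gamma(p,q)$ is the set of maps $\gamma : [0,1] \to B_T^n$ all of whose components are absolutely continuous, with $\gamma(0)=p$ and $\gamma(1)=q$. The length of such a curve is $\mathcal{L}(\gamma) = \int_0^1 \frac{\|\gamma'(t)\|_T}{1-\|\gamma(t)\|_T^2}\,dt$, and $d(p,q) = \inf_{\gamma\in\Gamma(p,q)} \mathcal{L}(\gamma)$. $H_n$ is the hyperoctahedral group of rank $n$: the symmetry group of the regular $n$-orthoplex, i.e. the group of signed permutations of the $n$ coordinates, of order $2^n n!$. *)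

theory Defs
  imports "HOL-Analysis.Analysis" "HOL-Algebra.Bij"
begin

definition norm_T :: "real ^ 'n \<Rightarrow> real" where
  "norm_T v = (\<Sum>i\<in>UNIV. \<bar>v $ i\<bar>)"

definition ball_T :: "(real ^ 'n) set" where
  "ball_T = {x. norm_T x < 1}"

text \<open>
  The usual epsilon-delta notion on a compact interval: \<open>D\<close> is a finite family of (end point pairs
  of) closed subintervals with pairwise disjoint interiors.  Degenerate pairs are harmless.
\<close>

definition abs_continuous_on_interval :: "real \<Rightarrow> real \<Rightarrow> (real \<Rightarrow> real) \<Rightarrow> bool" where
  "abs_continuous_on_interval a b f \<longleftrightarrow>
     (\<forall>\<epsilon>>0. \<exists>\<delta>>0. \<forall>D :: (real \<times> real) set.
        finite D \<and> (\<forall>(u, v)\<in>D. a \<le> u \<and> u \<le> v \<and> v \<le> b) \<and>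
        pairwise (\<lambda>I J. disjnt {fst I<..<snd I} {fst J<..<snd J}) D \<and>
        (\<Sum>(u, v)\<in>D. v - u) < \<delta>
        \<longrightarrow> (\<Sum>(u, v)\<in>D. \<bar>f v - f u\<bar>) < \<epsilon>)"

text \<open>Only the values of a curve on \<open>{0..1}\<close> matter, here and in its length.\<close>

definition curves_T :: "real ^ 'n \<Rightarrow> real ^ 'n \<Rightarrow> (real \<Rightarrow> real ^ 'n) set" where
  "curves_T p q = {\<gamma>. \<gamma> ` {0..1} \<subseteq> ball_T \<and>
     (\<forall>i. abs_continuous_on_interval 0 1 (\<lambda>t. \<gamma> t $ i)) \<and> \<gamma> 0 = p \<and> \<gamma> 1 = q}"

text \<open>
  An absolutely continuous curve is differentiable almost everywhere. The unspecified value of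
  \<open>vector_derivative\<close> on the remaining null set does not affect the integral, since
  the measure \<open>lebesgue\<close> is complete.  As the image of \<open>\<gamma>\<close> is a compact subset of the open ball,
  the integrand is integrable for every member of \<open>curves_T p q\<close>.  The infimum below is thus
  that of a nonempty set of nonnegative lengths whenever \<open>p\<close> and \<open>q\<close> lie in the ball.
\<close>

definition length_T :: "(real \<Rightarrow> real ^ 'n) \<Rightarrow> real" where
  "length_T \<gamma> =
     (LINT t:{0..1}|lebesgue. norm_T (vector_derivative \<gamma> (at t within {0..1})) / (1 - (norm_T (\<gamma> t))\<^sup>2))"

definition dist_T :: "real ^ 'n \<Rightarrow> real ^ 'n \<Rightarrow> real" where
  "dist_T p q = (INF \<gamma>\<in>curves_T p q. length_T \<gamma>)"

text \<open>
  Isometries of \<open>S\<close> are extensional, as in \<open>BijGroup\<close>, so that they are determined by their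
  values on \<open>S\<close>.
\<close>

definition isometry_group :: "'a set \<Rightarrow> ('a \<Rightarrow> 'a \<Rightarrow> real) \<Rightarrow> ('a \<Rightarrow> 'a) monoid" where
  "isometry_group S d =
     (BijGroup S)\<lparr>carrier := {f \<in> Bij S. \<forall>x\<in>S. \<forall>y\<in>S. d (f x) (f y) = d x y}\<rparr>"

definition signed_perm :: "('n \<Rightarrow> real) \<Rightarrow> ('n \<Rightarrow> 'n) \<Rightarrow> real ^ 'n \<Rightarrow> real ^ 'n" where
  "signed_perm s \<sigma> x = (\<chi> i. s i * x $ \<sigma> i)"

text \<open>
  The rank is \<open>CARD('n)\<close>.  The lemmas \<open>hyperoctahedral_eq_orthoplex_symmetries\<close> and
  \<open>card_hyperoctahedral_group\<close> below confirm the two other descriptions of this group.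
\<close>

definition hyperoctahedral_group :: "(real ^ 'n \<Rightarrow> real ^ 'n) monoid" where
  "hyperoctahedral_group =
     \<lparr>carrier = {signed_perm s \<sigma> | s \<sigma>. range s \<subseteq> {- 1, 1} \<and> bij \<sigma>},
      mult = (\<circ>),
      one = id\<rparr>"

lemma subgroup_isometries:
  "subgroup {f \<in> Bij S. \<forall>x\<in>S. \<forall>y\<in>S. d (f x) (f y) = d x y} (BijGroup S)"
    (is "subgroup ?H _")
proof (rule group.subgroupI[OF group_BijGroup])
  show "?H \<subseteq> carrier (BijGroup S)" by (auto simp: BijGroup_def)
  show "?H \<noteq> {}" using id_Bij[of S] by auto
next
  fix f assume f: "f \<in> ?H"
  then have bij: "bij_betw f S S" by (simp add: Bij_def)
  have "d (inv_into S f x) (inv_into S f y) = d x y" if "x \<in> S" "y \<in> S" for x y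
  proof -
    have "inv_into S f x \<in> S" "inv_into S f y \<in> S"
      using bij that by (auto simp: bij_betw_def inv_into_into)
    then show ?thesis
      using f bij_betw_inv_into_right[OF bij] that by fastforce
  qed
  then show "inv\<^bsub>BijGroup S\<^esub> f \<in> ?H"
    using f restrict_inv_into_Bij[of f S] by (simp add: inv_BijGroup)
next
  fix f g assume "f \<in> ?H" "g \<in> ?H"
  then show "f \<otimes>\<^bsub>BijGroup S\<^esub> g \<in> ?H"
    using Bij_imp_funcset[of g S]
    by (auto simp: BijGroup_def compose_Bij compose_eq Pi_iff)
qed

lemma group_isometry_group: "group (isometry_group S d)"
  unfolding isometry_group_def
  by (rule subgroup.subgroup_is_group[OF subgroup_isometries group_BijGroup])

lemma sign_cases:
  fixes s :: "'n \<Rightarrow> real"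
  assumes "range s \<subseteq> {- 1, 1}"
  shows "s i = - 1 \<or> s i = 1"
  using subsetD[OF assms rangeI[of s i]] by simp

lemma signed_perm_comp:
  "signed_perm s \<sigma> \<circ> signed_perm s' \<sigma>' = signed_perm (\<lambda>i. s i * s' (\<sigma> i)) (\<sigma>' \<circ> \<sigma>)"
  by (simp add: signed_perm_def fun_eq_iff vec_eq_iff)

lemma signed_perm_id: "signed_perm (\<lambda>_. 1) id = id"
  by (simp add: signed_perm_def fun_eq_iff vec_eq_iff)

lemma group_hyperoctahedral_group: "group hyperoctahedral_group"
proof (rule groupI)
  fix f g :: "real ^ 'n \<Rightarrow> real ^ 'n"
  assume "f \<in> carrier hyperoctahedral_group" "g \<in> carrier hyperoctahedral_group"
  then obtain s \<sigma> s' \<sigma>' where *: "f = signed_perm s \<sigma>" "range s \<subseteq> {- 1, 1}" "bij \<sigma>"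
    "g = signed_perm s' \<sigma>'" "range s' \<subseteq> {- 1, 1}" "bij \<sigma>'"
    by (auto simp: hyperoctahedral_group_def)
  have "range (\<lambda>i. s i * s' (\<sigma> i)) \<subseteq> {- 1, 1}" using *(2,5) by (fastforce simp: image_subset_iff)
  moreover have "bij (\<sigma>' \<circ> \<sigma>)" using * by (simp add: bij_comp)
  ultimately show "f \<otimes>\<^bsub>hyperoctahedral_group\<^esub> g \<in> carrier hyperoctahedral_group"
    using * by (auto simp: hyperoctahedral_group_def signed_perm_comp)
next
  show "\<one>\<^bsub>hyperoctahedral_group\<^esub> \<in> carrier (hyperoctahedral_group :: (real ^ 'n \<Rightarrow> real ^ 'n) monoid)"
    by (auto simp: hyperoctahedral_group_def intro!: exI[of _ "\<lambda>_. 1"] exI[of _ id] signed_perm_id[symmetric])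
next
  fix f :: "real ^ 'n \<Rightarrow> real ^ 'n"
  assume "f \<in> carrier hyperoctahedral_group"
  then obtain s \<sigma> where *: "f = signed_perm s \<sigma>" "range s \<subseteq> {- 1, 1}" "bij \<sigma>"
    by (auto simp: hyperoctahedral_group_def)
  let ?g = "signed_perm (\<lambda>i. s (inv_into UNIV \<sigma> i)) (inv_into UNIV \<sigma>)"
  have "s i * s i = 1" for i
    using sign_cases[OF *(2), of i] by auto
  moreover have "\<sigma> \<circ> inv_into UNIV \<sigma> = id"
    using *(3) by (simp add: bij_is_surj flip: surj_iff)
  ultimately have "?g \<circ> f = id"
    by (simp add: *(1) signed_perm_comp signed_perm_id)
  moreover have "?g \<in> carrier hyperoctahedral_group"
    using * by (auto simp: hyperoctahedral_group_def bij_imp_bij_inv intro!: exI[of _ "\<lambda>i. s (inv_into UNIV \<sigma> i)"] exI[of _ "inv_into UNIV \<sigma>"])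
  ultimately show "\<exists>g\<in>carrier hyperoctahedral_group. g \<otimes>\<^bsub>hyperoctahedral_group\<^esub> f = \<one>\<^bsub>hyperoctahedral_group\<^esub>"
    by (auto simp: hyperoctahedral_group_def)
qed (auto simp: hyperoctahedral_group_def o_assoc)

lemma signed_perm_axis:
  assumes "bij \<sigma>"
  shows "signed_perm s \<sigma> (axis j c) = axis (inv_into UNIV \<sigma> j) (s (inv_into UNIV \<sigma> j) * c)"
proof -
  have "\<sigma> i = j \<longleftrightarrow> i = inv_into UNIV \<sigma> j" for i using assms by (metis bij_inv_eq_iff)
  then show ?thesis by (auto simp: signed_perm_def axis_def vec_eq_iff)
qed

lemma linear_signed_perm: "linear (signed_perm s \<sigma>)"
  by (auto simp: signed_perm_def linear_iff vec_eq_iff algebra_simps)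

lemma card_hyperoctahedral_group:
  "card (carrier (hyperoctahedral_group :: (real ^ 'n \<Rightarrow> real ^ 'n) monoid)) = 2 ^ CARD('n) * fact CARD('n)"
proof -
  let ?A = "{s :: 'n \<Rightarrow> real. range s \<subseteq> {- 1, 1}} \<times> {\<sigma> :: 'n \<Rightarrow> 'n. bij \<sigma>}"
  have inj: "inj_on (\<lambda>(s, \<sigma>). signed_perm s \<sigma>) ?A"
  proof (rule inj_onI, clarsimp)
    fix s s' :: "'n \<Rightarrow> real" and \<sigma> \<sigma>' :: "'n \<Rightarrow> 'n"
    assume a: "range s \<subseteq> {- 1, 1}" "range s' \<subseteq> {- 1, 1}" "signed_perm s \<sigma> = signed_perm s' \<sigma>'"
    have eq: "s i * axis j 1 $ \<sigma> i = s' i * axis j 1 $ \<sigma>' i" for i j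
      using fun_cong[OF a(3), of "axis j 1"] by (simp add: signed_perm_def vec_eq_iff)
    have nz: "s i \<noteq> 0" for i using sign_cases[OF a(1), of i] by auto
    have "\<sigma> i = \<sigma>' i" for i
      using eq[of i "\<sigma> i"] nz[of i] by (auto simp: axis_def split: if_splits)
    moreover have "s i = s' i" for i
      using eq[of i "\<sigma> i"] \<open>\<sigma> i = \<sigma>' i\<close> by (auto simp: axis_def)
    ultimately show "s = s' \<and> \<sigma> = \<sigma>'" by auto
  qed
  have "carrier hyperoctahedral_group = (\<lambda>(s, \<sigma>). signed_perm s \<sigma>) ` ?A"
    by (auto simp: hyperoctahedral_group_def)
  then have "card (carrier (hyperoctahedral_group :: (real ^ 'n \<Rightarrow> real ^ 'n) monoid)) = card ?A"
    by (simp add: card_image[OF inj])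
  moreover have "{s :: 'n \<Rightarrow> real. range s \<subseteq> {- 1, 1}} = UNIV \<rightarrow>\<^sub>E {- 1, 1}"
    by (auto simp: PiE_def)
  then have "card {s :: 'n \<Rightarrow> real. range s \<subseteq> {- 1, 1}} = 2 ^ CARD('n)"
    by (simp add: card_PiE numeral_2_eq_2)
  moreover have "card {\<sigma> :: 'n \<Rightarrow> 'n. bij \<sigma>} = fact CARD('n)"
    using card_permutations[of "UNIV :: 'n set" "CARD('n)"]
    by (simp add: permutes_def bij_iff)
  ultimately show ?thesis by (simp add: card_cartesian_product)
qed

definition orthoplex :: "(real ^ 'n) set" where
  "orthoplex = convex hull {axis i c | i c. c \<in> {- 1, 1}}"

lemma orthoplex_norm_T: "x \<in> orthoplex \<Longrightarrow> norm_T x \<le> 1"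
proof -
  have "convex {x :: real ^ 'n. norm_T x \<le> 1}"
  proof (rule convexI, clarsimp)
    fix x y :: "real ^ 'n" and u v :: real
    assume *: "norm_T x \<le> 1" "norm_T y \<le> 1" "0 \<le> u" "0 \<le> v" "u + v = 1"
    have "norm_T (u *\<^sub>R x + v *\<^sub>R y) \<le> u * norm_T x + v * norm_T y"
      unfolding norm_T_def sum_distrib_left sum.distrib[symmetric]
      by (rule sum_mono) (use *(3,4) in \<open>simp add: order.trans[OF abs_triangle_ineq] abs_mult\<close>)
    also have "\<dots> \<le> 1" using * by (metis convex_bound_le)
    finally show "norm_T (u *\<^sub>R x + v *\<^sub>R y) \<le> 1" .
  qed
  moreover have "{axis i c | i c. c \<in> {- 1, 1}} \<subseteq> {x :: real ^ 'n. norm_T x \<le> 1}"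
    by (auto simp: norm_T_def axis_def if_distrib[of abs] cong: if_cong)
  ultimately have "(orthoplex :: (real ^ 'n) set) \<subseteq> {x. norm_T x \<le> 1}"
    unfolding orthoplex_def by (rule hull_minimal[rotated])
  then show "x \<in> orthoplex \<Longrightarrow> norm_T x \<le> 1" for x :: "real ^ 'n" by auto
qed

lemma norm_T_le_norm_imp_axis:
  fixes x :: "real ^ 'n"
  assumes "norm x = 1" "norm_T x \<le> 1"
  obtains i c where "c \<in> {- 1, 1}" "x = axis i c"
proof -
  have le1: "\<bar>x $ i\<bar> \<le> 1" for i using component_le_norm_cart[of x i] assms(1) by simp
  have sq: "(\<Sum>i\<in>UNIV. (x $ i)\<^sup>2) = 1"
    using assms(1) by (simp add: norm_eq_1 inner_vec_def power2_eq_square)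
  have nn: "0 \<le> \<bar>x $ i\<bar> - (x $ i)\<^sup>2" for i
    using mult_right_mono[OF le1[of i], of "\<bar>x $ i\<bar>"] by (simp add: power2_eq_square)
  have "(\<Sum>i\<in>UNIV. \<bar>x $ i\<bar> - (x $ i)\<^sup>2) \<le> 0"
    using assms(2) sq by (simp add: sum_subtractf norm_T_def)
  then have "(\<Sum>i\<in>UNIV. \<bar>x $ i\<bar> - (x $ i)\<^sup>2) = 0"
    using nn by (meson antisym sum_nonneg)
  then have "\<bar>x $ i\<bar> - (x $ i)\<^sup>2 = 0" for i
    using nn by (simp add: sum_nonneg_eq_0_iff)
  then have "\<bar>x $ i\<bar> * (1 - \<bar>x $ i\<bar>) = 0" for i
    by (metis abs_mult_self_eq mult.right_neutral power2_eq_square right_diff_distrib)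
  then have zo: "x $ i = 0 \<or> \<bar>x $ i\<bar> = 1" for i
    unfolding mult_eq_0_iff by (metis abs_eq_0 eq_iff_diff_eq_0)
  obtain i where i: "x $ i \<noteq> 0" using assms(1) by (metis norm_zero vec_eq_iff zero_index zero_neq_one)
  have "x $ j = 0" if "j \<noteq> i" for j
  proof (rule ccontr)
    assume "x $ j \<noteq> 0"
    then have "(\<Sum>k\<in>{i, j}. \<bar>x $ k\<bar>) = 2" using that i zo[of i] zo[of j] by simp
    moreover have "(\<Sum>k\<in>{i, j}. \<bar>x $ k\<bar>) \<le> norm_T x"
      unfolding norm_T_def by (rule sum_mono2) auto
    ultimately show False using assms(2) by simp
  qed
  then have "x = axis i (x $ i)" by (auto simp: axis_def vec_eq_iff)
  moreover have "x $ i \<in> {- 1, 1}" using i zo[of i] by auto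
  ultimately show ?thesis using that by blast
qed

lemma hyperoctahedral_eq_orthoplex_symmetries:
  "carrier (hyperoctahedral_group :: (real ^ 'n \<Rightarrow> real ^ 'n) monoid) =
     {f. orthogonal_transformation f \<and> f ` orthoplex = orthoplex}"
proof (intro equalityI subsetI)
  fix f :: "real ^ 'n \<Rightarrow> real ^ 'n"
  assume "f \<in> carrier hyperoctahedral_group"
  then obtain s \<sigma> where *: "f = signed_perm s \<sigma>" "range s \<subseteq> {- 1, 1}" "bij \<sigma>"
    by (auto simp: hyperoctahedral_group_def)
  have ss: "s i * s i = 1" for i using sign_cases[OF *(2), of i] by auto
  have "f v \<bullet> f w = v \<bullet> w" for v w
  proof -
    have "f v \<bullet> f w = (\<Sum>i\<in>UNIV. (s i * s i) * (v $ \<sigma> i * w $ \<sigma> i))"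
      by (simp add: *(1) signed_perm_def inner_vec_def algebra_simps)
    also have "\<dots> = (\<Sum>i\<in>UNIV. v $ i * w $ i)"
      using sum.reindex_bij_betw[of \<sigma> UNIV UNIV "\<lambda>i. v $ i * w $ i"] *(3) ss by simp
    finally show ?thesis by (simp add: inner_vec_def)
  qed
  then have "orthogonal_transformation f"
    by (simp add: orthogonal_transformation_def *(1) linear_signed_perm)
  moreover have "f ` {axis i c | i c. c \<in> {- 1, 1}} = {axis i c | i c. c \<in> {- 1, 1}}"
  proof (intro equalityI subsetI)
    fix y assume "y \<in> f ` {axis i c | i c. c \<in> {- 1, 1}}"
    then obtain i c where c: "c \<in> {- 1, 1}" and y: "y = f (axis i c)" by blast
    have "y = axis (inv_into UNIV \<sigma> i) (s (inv_into UNIV \<sigma> i) * c)"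
      by (simp add: y *(1) signed_perm_axis[OF *(3)])
    moreover have "s (inv_into UNIV \<sigma> i) * c \<in> {- 1, 1}"
      using sign_cases[OF *(2), of "inv_into UNIV \<sigma> i"] c by auto
    ultimately show "y \<in> {axis i c | i c. c \<in> {- 1, 1}}" by auto
  next
    fix y :: "real ^ 'n" assume "y \<in> {axis i c | i c. c \<in> {- 1, 1}}"
    then obtain i c where ic: "c \<in> {- 1, 1}" "y = axis i c" by blast
    have "f (axis (\<sigma> i) (s i * c)) = y"
      using * ic ss[of i] by (simp add: signed_perm_axis bij_is_inj mult.assoc[symmetric])
    moreover have "s i * c \<in> {- 1, 1}" using sign_cases[OF *(2), of i] ic by auto
    ultimately show "y \<in> f ` {axis i c | i c. c \<in> {- 1, 1}}" by blast
  qed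
  then have "f ` orthoplex = orthoplex"
    unfolding orthoplex_def *(1)
    by (simp only: convex_hull_linear_image[OF linear_signed_perm])
  ultimately show "f \<in> {f. orthogonal_transformation f \<and> f ` orthoplex = orthoplex}" by simp
next
  fix f :: "real ^ 'n \<Rightarrow> real ^ 'n"
  assume "f \<in> {f. orthogonal_transformation f \<and> f ` orthoplex = orthoplex}"
  then have f: "orthogonal_transformation f" "f ` orthoplex = orthoplex" by auto
  have "\<exists>k c. c \<in> {- 1, 1} \<and> f (axis j 1) = axis k c" for j
  proof -
    have "axis j 1 \<in> (orthoplex :: (real ^ 'n) set)"
      unfolding orthoplex_def by (rule hull_inc) auto
    then have "norm_T (f (axis j 1)) \<le> 1" using f(2) orthoplex_norm_T by blast
    moreover have "norm (f (axis j 1)) = 1"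
      using f(1) by (simp add: orthogonal_transformation)
    ultimately show ?thesis by (metis norm_T_le_norm_imp_axis)
  qed
  then obtain \<tau> c where c: "\<And>j. c j \<in> {- 1, 1 :: real}" and fa: "\<And>j. f (axis j 1) = axis (\<tau> j) (c j)"
    by metis
  have cn: "c j \<noteq> 0" for j using c[of j] by auto
  have "inj \<tau>"
  proof (rule injI, rule ccontr)
    fix j k assume jk: "\<tau> j = \<tau> k" "j \<noteq> k"
    have "f (axis j 1) \<bullet> f (axis k 1) = 0"
      using f(1) jk by (simp add: orthogonal_transformation_def inner_axis_axis)
    then show False using fa jk cn by (simp add: inner_axis_axis)
  qed
  then have bij: "bij \<tau>" by (simp add: bij_def finite_UNIV_inj_surj)
  let ?g = "signed_perm (\<lambda>i. c (inv_into UNIV \<tau> i)) (inv_into UNIV \<tau>)"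
  have "f x = ?g x" for x
  proof (rule linear_eq_on_span[of f ?g Basis])
    show "linear f" using f(1) by (simp add: orthogonal_transformation_def)
    show "linear ?g" by (rule linear_signed_perm)
    show "x \<in> span Basis" by simp
    fix b :: "real ^ 'n" assume "b \<in> Basis"
    then obtain j where "b = axis j 1" by (auto simp: Basis_vec_def)
    then show "f b = ?g b"
      using bij fa by (simp add: signed_perm_axis bij_imp_bij_inv inv_inv_eq bij_is_inj)
  qed
  then have "f = ?g" by auto
  moreover have "range (\<lambda>i. c (inv_into UNIV \<tau> i)) \<subseteq> {- 1, 1}" using c by blast
  ultimately show "f \<in> carrier hyperoctahedral_group"
    using bij_imp_bij_inv[OF bij] unfolding hyperoctahedral_group_def by auto
qed

end

theory Submission
  imports Defs
begin

text \<open>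
  For \<open>p\<close> and \<open>q\<close> in the ball let \<open>m\<close> be the componentwise meet: the coordinate of smaller modulus
  where the signs agree, and \<open>0\<close> elsewhere.  A curve from \<open>p\<close> to \<open>q\<close> has \<open>norm_T\<close>-length at least
  \<open>norm_T (p - q)\<close>, so it either dips to the level \<open>norm_T m\<close> or makes a detour at higher and hence more
  expensive levels; the optimal curve goes straight to \<open>m\<close> and then straight to \<open>q\<close>.  Therefore
  \<open>dist_T p q = artanh (norm_T p) + artanh (norm_T q) - 2 * artanh (norm_T m)\<close>.

  If \<open>n \<ge> 2\<close>, the origin is the only point \<open>x\<close> such that every triple \<open>x, a, b\<close> has a median, so isometries
  fix it.  They then preserve \<open>norm_T\<close> and the norm of the meet, hence permute the coordinate half-axes
  respecting opposites, and the meet with points of the half-axes recovers the coordinates.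
\<close>

section \<open>Absolutely continuous functions\<close>

text \<open>A length is a Lebesgue integral of a derivative that exists only almost everywhere, so
  the lower bound for lengths rests on the fundamental theorem of calculus for absolutely continuous
  functions, obtained here from Vitali covers and gauges. The norm itself is not differentiable
  where a coordinate vanishes; therefore the level \<open>norm_T (\<gamma> t)\<close> is treated as
  an absolutely continuous function in its own right, whose rate of change is at most the speed.

  \<open>artanh\<close> enters as the primitive of the density \<open>1 / (1 - s\<^sup>2)\<close>.
  As the density grows with the level, low levels are cheap, and the meet is the point of least norm
  in the coordinate box spanned by \<open>p\<close> and \<open>q\<close>.

  Medians are expressed by distances alone, so isometries respect them. In dimension 1 they could
  not single out the origin: there \<open>artanh\<close> makes the ball isometric to the real line,
  in which every triple has a median and translations are isometries.\<close>

definition nonoverlapping_in :: "real \<Rightarrow> real \<Rightarrow> (real \<times> real) set \<Rightarrow> bool" where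
  "nonoverlapping_in a b D \<longleftrightarrow> finite D \<and> (\<forall>(u, v)\<in>D. a \<le> u \<and> u \<le> v \<and> v \<le> b) \<and>
     pairwise (\<lambda>I J. disjnt {fst I<..<snd I} {fst J<..<snd J}) D"

lemma nonoverlapping_in_le: "nonoverlapping_in a b D \<Longrightarrow> (u, v) \<in> D \<Longrightarrow> a \<le> u \<and> u \<le> v \<and> v \<le> b"
  unfolding nonoverlapping_in_def by blast

lemma abs_continuous_iff:
  "abs_continuous_on_interval a b f \<longleftrightarrow> (\<forall>e>0. \<exists>d>0. \<forall>D. nonoverlapping_in a b D \<longrightarrow>
     (\<Sum>(u, v)\<in>D. v - u) < d \<longrightarrow> (\<Sum>(u, v)\<in>D. \<bar>f v - f u\<bar>) < e)"
  unfolding abs_continuous_on_interval_def nonoverlapping_in_def imp_conjL by (rule refl)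

lemma abs_continuousE:
  assumes "abs_continuous_on_interval a b f" "e > 0"
  obtains d where "d > 0"
    "\<And>D. nonoverlapping_in a b D \<Longrightarrow> (\<Sum>(u, v)\<in>D. v - u) < d \<Longrightarrow> (\<Sum>(u, v)\<in>D. \<bar>f v - f u\<bar>) < e"
  using assms unfolding abs_continuous_iff by blast

text \<open>Exchanges pairs of end points for the interval sets of \<open>division_of\<close>, the
  form in which Vitali covers and tagged partitions deliver their families. Each member is a
  nonempty closed interval, so \<open>Inf\<close> and \<open>Sup\<close> recover its pair.\<close>

lemma abs_continuous_division:
  assumes ac: "abs_continuous_on_interval a b f" and "e > 0"
  obtains d where "d > 0"
    "\<And>D S. \<lbrakk>D division_of S; S \<subseteq> {a..b}; (\<Sum>k\<in>D. measure lebesgue k) < d\<rbrakk>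
       \<Longrightarrow> (\<Sum>k\<in>D. \<bar>f (Sup k) - f (Inf k)\<bar>) < e"
proof -
  obtain d where "d > 0" and
    d: "\<And>D. nonoverlapping_in a b D \<Longrightarrow> (\<Sum>(u, v)\<in>D. v - u) < d \<Longrightarrow> (\<Sum>(u, v)\<in>D. \<bar>f v - f u\<bar>) < e"
    using abs_continuousE[OF assms] by blast
  show thesis
  proof (rule that[OF \<open>d > 0\<close>])
    fix D S assume D: "D division_of S" "S \<subseteq> {a..b}" and small: "(\<Sum>k\<in>D. measure lebesgue k) < d"
    have k: "k = {Inf k..Sup k} \<and> a \<le> Inf k \<and> Inf k \<le> Sup k \<and> Sup k \<le> b" if kD: "k \<in> D" for k
    proof -
      obtain u v where uv: "k = {u..v}" using division_ofD(4)[OF D(1) kD] by auto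
      moreover have "u \<le> v" using division_ofD(3)[OF D(1) kD] uv by auto
      moreover have "k \<subseteq> {a..b}" using division_ofD(2)[OF D(1) kD] D(2) by auto
      ultimately show ?thesis by auto
    qed
    then have k_bds: "a \<le> Inf k" "Inf k \<le> Sup k" "Sup k \<le> b" if "k \<in> D" for k
      using that by simp_all
    let ?h = "\<lambda>k :: real set. (Inf k, Sup k)"
    have inj: "inj_on ?h D"
    proof (rule inj_onI)
      fix k l assume "k \<in> D" "l \<in> D" "?h k = ?h l"
      then show "k = l" using k[of k] k[of l] by (metis Pair_inject)
    qed
    have "pairwise (\<lambda>I J. disjnt {fst I<..<snd I} {fst J<..<snd J}) (?h ` D)"
    proof (rule pairwiseI)
      fix I J assume "I \<in> ?h ` D" "J \<in> ?h ` D" "I \<noteq> J"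
      then obtain k l where kl: "k \<in> D" "l \<in> D" "k \<noteq> l" and IJ: "I = ?h k" "J = ?h l" by blast
      then have "interior k \<inter> interior l = {}" using division_ofD(5)[OF D(1)] by blast
      moreover have "interior k = {Inf k<..<Sup k}" "interior l = {Inf l<..<Sup l}"
        using k[OF kl(1)] k[OF kl(2)] interior_atLeastAtMost_real[of "Inf k" "Sup k"]
          interior_atLeastAtMost_real[of "Inf l" "Sup l"] by argo+
      ultimately show "disjnt {fst I<..<snd I} {fst J<..<snd J}" by (simp add: disjnt_def IJ)
    qed
    moreover have "measure lebesgue k = Sup k - Inf k" if "k \<in> D" for k
    proof -
      have "measure lebesgue {Inf k..Sup k} = Sup k - Inf k" using k_bds(2)[OF that] by simp
      then show ?thesis using k[OF that] by metis
    qed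
    then have "(\<Sum>(u, v)\<in>?h ` D. v - u) < d"
      using small by (simp add: sum.reindex[OF inj])
    moreover have "finite D" using division_ofD(1)[OF D(1)] .
    ultimately have "(\<Sum>(u, v)\<in>?h ` D. \<bar>f v - f u\<bar>) < e"
      by (intro d) (auto simp: nonoverlapping_in_def k_bds)
    then show "(\<Sum>k\<in>D. \<bar>f (Sup k) - f (Inf k)\<bar>) < e"
      by (simp add: sum.reindex[OF inj])
  qed
qed

lemma division_telescope:
  fixes f :: "real \<Rightarrow> real"
  assumes D: "D division_of {a..b}" and "a \<le> b"
  shows "(\<Sum>k\<in>D. f (Sup k) - f (Inf k)) = f b - f a"
proof -
  \<comment> \<open>Any tag in \<open>k\<close> would do; \<open>Inf k\<close> lies in
    \<open>k\<close> because \<open>k\<close> is closed and nonempty.\<close>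
  let ?p = "(\<lambda>k. (Inf k, k)) ` D"
  have "?p tagged_division_of {a..b}"
  proof (rule tagged_division_ofI)
    show "finite ?p" using division_ofD(1)[OF D] by simp
    fix x k assume "(x, k) \<in> ?p"
    then have k: "k \<in> D" "x = Inf k" by auto
    then show "\<exists>u v. k = cbox u v" using division_ofD(4)[OF D] by blast
    then show "x \<in> k" using division_ofD(3)[OF D k(1)] k(2) by auto
    show "k \<subseteq> {a..b}" using division_ofD(2)[OF D] k by blast
  next
    fix x k y l assume "(x, k) \<in> ?p" "(y, l) \<in> ?p" "(x, k) \<noteq> (y, l)"
    then show "interior k \<inter> interior l = {}" using division_ofD(5)[OF D, of k l] by auto
  next
    have "{k. \<exists>x. (x, k) \<in> ?p} = D" by auto
    then show "\<Union>{k. \<exists>x. (x, k) \<in> ?p} = {a..b}"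
      using division_ofD(6)[OF D] by simp
  qed
  from additive_tagged_division_1[OF \<open>a \<le> b\<close> this, of f]
  show ?thesis by (subst (asm) sum.reindex) (auto simp: inj_on_def)
qed

section \<open>Vitali covers and differentiability almost everywhere\<close>

lemma Vitali_covering_intervals:
  fixes S :: "real set"
  assumes "\<forall>x\<in>S. \<forall>e>0. \<exists>u v. u < v \<and> x \<in> {u..v} \<and> v - u < e \<and> P u v"
  shows "\<exists>\<C>. countable \<C> \<and> disjoint \<C> \<and>
    (\<forall>k\<in>\<C>. Inf k < Sup k \<and> k = {Inf k..Sup k} \<and> P (Inf k) (Sup k)) \<and> negligible (S - \<Union>\<C>)"
proof -
  \<comment> \<open>A pair indexes the ball around its midpoint with half its length as radius,
    which is \<open>{u..v}\<close>. The covering theorem lets \<open>x\<close> be anywhere in the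
    ball, so also an end point, and the intervals that come from difference quotients at
    \<open>x\<close> are of this kind.\<close>
  let ?a = "\<lambda>(u, v). (u + v) / 2 :: real" and ?r = "\<lambda>(u, v). (v - u) / 2 :: real"
  let ?K = "{(u, v). u < v \<and> P u v}"
  let ?c = "\<lambda>i. cball (?a i) (?r i)"
  have cb: "?c (u, v) = {u..v}" for u v
    by (simp add: cball_eq_atLeastAtMost field_simps)
  have 1: "0 < ?r i" if "i \<in> ?K" for i using that by auto
  have 2: "\<exists>i. i \<in> ?K \<and> x \<in> ?c i \<and> ?r i < d" if "x \<in> S" "0 < d" for x d
  proof -
    obtain u v where "u < v \<and> x \<in> {u..v} \<and> v - u < d \<and> P u v"
      using assms[rule_format, OF \<open>x \<in> S\<close> \<open>0 < d\<close>] by (elim exE)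
    then show ?thesis by (intro exI[of _ "(u, v)"]) (simp only: cb, auto)
  qed
  obtain C where C: "countable C" "C \<subseteq> ?K" "pairwise (\<lambda>i j. disjnt (?c i) (?c j)) C"
    "negligible (S - (\<Union>i\<in>C. ?c i))"
    by (rule Vitali_covering_theorem_cballs[of ?K ?r S ?a, OF 1 2])
  show ?thesis
  proof (intro exI[of _ "?c ` C"] conjI ballI)
    show "countable (?c ` C)" using C(1) by blast
    show "disjoint (?c ` C)" using C(3) by (auto simp: pairwise_def)
    show "negligible (S - \<Union> (?c ` C))" by (rule C(4))
    fix k assume "k \<in> ?c ` C"
    then obtain u v where "u < v" "P u v" "k = {u..v}" using C(2) cb by auto
    then show "Inf k < Sup k" "k = {Inf k..Sup k}" "P (Inf k) (Sup k)" by auto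
  qed
qed

text \<open>Subtracting a linear function shifts every difference quotient by \<open>c\<close>; this
  is used to make two slope thresholds symmetric about 0.\<close>

lemma abs_continuous_diff_linear:
  assumes "abs_continuous_on_interval a b f"
  shows "abs_continuous_on_interval a b (\<lambda>x. f x - c * x)"
  unfolding abs_continuous_iff
proof (intro allI impI)
  fix e :: real assume "e > 0"
  then have "e / 2 > 0" by simp
  from abs_continuousE[OF assms this] obtain d where "d > 0" and
    d: "\<And>D. nonoverlapping_in a b D \<Longrightarrow> (\<Sum>(u, v)\<in>D. v - u) < d \<Longrightarrow> (\<Sum>(u, v)\<in>D. \<bar>f v - f u\<bar>) < e / 2"
    by blast
  \<comment> \<open>The summand 1 keeps the denominator positive when \<open>c = 0\<close>.\<close>
  let ?d = "min d (e / (2 * (\<bar>c\<bar> + 1)))"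
  have "?d > 0" using \<open>d > 0\<close> \<open>e > 0\<close> by simp
  moreover have "(\<Sum>(u, v)\<in>D. \<bar>f v - c * v - (f u - c * u)\<bar>) < e"
    if D: "nonoverlapping_in a b D" "(\<Sum>(u, v)\<in>D. v - u) < ?d" for D
  proof -
    have "(\<Sum>(u, v)\<in>D. \<bar>f v - c * v - (f u - c * u)\<bar>) \<le> (\<Sum>(u, v)\<in>D. \<bar>f v - f u\<bar> + \<bar>c\<bar> * (v - u))"
    proof (rule sum_mono, clarify)
      fix u v assume "(u, v) \<in> D"
      then have "u \<le> v" using nonoverlapping_in_le[OF D(1)] by blast
      have "\<bar>f v - c * v - (f u - c * u)\<bar> = \<bar>(f v - f u) - c * (v - u)\<bar>" by (simp add: algebra_simps)
      also have "\<dots> \<le> \<bar>f v - f u\<bar> + \<bar>c * (v - u)\<bar>" by (rule abs_triangle_ineq4)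
      finally show "\<bar>f v - c * v - (f u - c * u)\<bar> \<le> \<bar>f v - f u\<bar> + \<bar>c\<bar> * (v - u)"
        using \<open>u \<le> v\<close> by (simp add: abs_mult)
    qed
    also have "\<dots> = (\<Sum>(u, v)\<in>D. \<bar>f v - f u\<bar>) + \<bar>c\<bar> * (\<Sum>(u, v)\<in>D. v - u)"
      by (simp add: sum.distrib sum_distrib_left case_prod_unfold)
    also have "\<dots> < e / 2 + e / 2"
    proof (rule add_less_le_mono)
      show "(\<Sum>(u, v)\<in>D. \<bar>f v - f u\<bar>) < e / 2" using d D by simp
      have "\<bar>c\<bar> * (\<Sum>(u, v)\<in>D. v - u) \<le> \<bar>c\<bar> * (e / (2 * (\<bar>c\<bar> + 1)))"
        using D(2) by (intro mult_left_mono) auto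
      also have "\<dots> \<le> (\<bar>c\<bar> + 1) * (e / (2 * (\<bar>c\<bar> + 1)))"
        using \<open>e > 0\<close> by (intro mult_right_mono) auto
      also have "\<dots> = e / 2" by (simp add: field_simps add_pos_nonneg)
      finally show "\<bar>c\<bar> * (\<Sum>(u, v)\<in>D. v - u) \<le> e / 2" .
    qed
    finally show ?thesis by simp
  qed
  ultimately show "\<exists>d>0. \<forall>D. nonoverlapping_in a b D \<longrightarrow> (\<Sum>(u, v)\<in>D. v - u) < d \<longrightarrow>
     (\<Sum>(u, v)\<in>D. \<bar>f v - c * v - (f u - c * u)\<bar>) < e"
    by blast
qed

lemma abs_continuous_subinterval:
  assumes "abs_continuous_on_interval a b f" "a \<le> c" "d \<le> b"
  shows "abs_continuous_on_interval c d f"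
proof -
  have "nonoverlapping_in a b D" if "nonoverlapping_in c d D" for D
    using that assms(2,3) unfolding nonoverlapping_in_def by fastforce
  then show ?thesis using assms(1) unfolding abs_continuous_iff by meson
qed

lemma disjoint_intervals_division:
  fixes F :: "real set set"
  assumes "finite F" "disjoint F" "\<And>k. k \<in> F \<Longrightarrow> Inf k < Sup k \<and> k = {Inf k..Sup k}"
  shows "F division_of \<Union>F"
proof (rule division_ofI)
  fix k assume "k \<in> F"
  then have k: "Inf k < Sup k" "k = {Inf k..Sup k}" using assms(3) by blast+
  then show "k \<noteq> {}" by (metis atLeastatMost_empty_iff2 less_imp_not_less less_le_not_le)
  show "\<exists>u v. k = cbox u v" using k(2) by (metis cbox_interval)
next
  fix k l assume "k \<in> F" "l \<in> F" "k \<noteq> l"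
  then have "k \<inter> l = {}" using assms(2) by (auto simp: pairwise_def disjnt_def)
  then show "interior k \<inter> interior l = {}" using interior_subset by blast
qed (use assms(1) in auto)

text \<open>Supplies the Vitali covers: a difference quotient taken close to \<open>x\<close> is the
  slope of a short interval with \<open>x\<close> as an end point. Being symmetric in its two
  points, it does not depend on the side of \<open>x\<close> on which \<open>y\<close> lies.\<close>

lemma slope_frequently_interval:
  fixes f :: "real \<Rightarrow> real"
  assumes "\<exists>\<^sub>F y in at x. P ((f y - f x) / (y - x))" "open W" "x \<in> W" "e > 0"
  shows "\<exists>u v. u < v \<and> x \<in> {u..v} \<and> v - u < e \<and> {u..v} \<subseteq> W \<and> P ((f v - f u) / (v - u))"
proof -
  obtain r where "r > 0" and r: "ball x r \<subseteq> W" using assms(2,3) open_contains_ball by blast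
  have "\<forall>\<^sub>F y in at x. y \<in> ball x (min r e) \<and> y \<noteq> x"
    using \<open>r > 0\<close> \<open>e > 0\<close> by (auto simp: eventually_at dist_commute intro!: exI[of _ "min r e"])
  from frequently_eventually_frequently[OF assms(1) this]
  obtain y where y: "P ((f y - f x) / (y - x))" "y \<in> ball x (min r e)" "y \<noteq> x"
    using frequently_ex by blast
  have flip: "(f x - f y) / (x - y) = (f y - f x) / (y - x)"
    using minus_divide_divide[of "f y - f x" "y - x"] by simp
  have "{min x y..max x y} \<subseteq> ball x r" using y(2) by (auto simp: dist_real_def)
  then have "{min x y..max x y} \<subseteq> W" using r by blast
  moreover have "P ((f (max x y) - f (min x y)) / (max x y - min x y))"
    using y(1) flip by (auto simp: max_def min_def)
  moreover have "min x y < max x y" "max x y - min x y < e" using y(2,3) by (auto simp: dist_real_def)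
  ultimately show ?thesis by (intro exI[of _ "min x y"] exI[of _ "max x y"]) simp
qed

text \<open>
  Two nested Vitali covers, the outer one by intervals of slope \<open>< - r\<close> and the inner one by intervals of
  slope \<open>> r\<close>, both exhaust the outer measure \<open>m\<close> up to \<open>e\<close>.  By absolute continuity the increments over
  the short gaps between them cannot account for the difference of the two total increments.
\<close>

lemma negligible_frequently_opposite_slopes:
  assumes ac: "abs_continuous_on_interval a b g" and "r > 0"
  shows "negligible {x \<in> {a<..<b}. (\<exists>\<^sub>F y in at x. (g y - g x) / (y - x) < - r) \<and>
           (\<exists>\<^sub>F y in at x. (g y - g x) / (y - x) > r)}"
proof -
  define S where "S = {x \<in> {a<..<b}. (\<exists>\<^sub>F y in at x. (g y - g x) / (y - x) < - r) \<and>
    (\<exists>\<^sub>F y in at x. (g y - g x) / (y - x) > r)}"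
  have S_sub: "S \<subseteq> {a<..<b}" by (auto simp: S_def)
  let ?\<mu> = "measure lebesgue"
  let ?M = "{?\<mu> T | T. S \<subseteq> T \<and> T \<in> lmeasurable}"
  \<comment> \<open>\<open>S\<close> is not known to be measurable, so its outer measure is
    approximated through measurable supersets.\<close>
  define m where "m = Inf ?M"
  have bdd: "bdd_below ?M" by (intro bdd_belowI[of _ 0]) auto
  have "?\<mu> {a<..<b} \<in> ?M" by (intro CollectI exI[of _ "{a<..<b}"]) (auto simp: S_sub)
  then have ne: "?M \<noteq> {}" by blast
  have m_le: "m \<le> ?\<mu> T" if "S \<subseteq> T" "T \<in> lmeasurable" for T
    unfolding m_def using that by (intro cInf_lower bdd) auto
  have "m \<le> 0"
  proof (rule ccontr)
    assume "\<not> m \<le> 0"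
    then have "m > 0" by simp
    then have "r * m / 2 > 0" using \<open>r > 0\<close> by simp
    from abs_continuous_division[OF ac this] obtain d where "d > 0" and
      d: "\<And>D S. \<lbrakk>D division_of S; S \<subseteq> {a..b}; (\<Sum>k\<in>D. ?\<mu> k) < d\<rbrakk>
         \<Longrightarrow> (\<Sum>k\<in>D. \<bar>g (Sup k) - g (Inf k)\<bar>) < r * m / 2" by blast
    \<comment> \<open>The gaps will have total length below \<open>2 * e\<close>, hence below
      \<open>d\<close>. The outer intervals will have measure at least \<open>m - e\<close>, hence
      at least \<open>m / 2\<close>, so that their total increment is at most
      \<open>- (r * m / 2)\<close>.\<close>
    define e where "e = min (d / 2) (m / 2)"
    have e: "0 < e" "2 * e \<le> d" "e \<le> m / 2" using \<open>d > 0\<close> \<open>m > 0\<close> by (auto simp: e_def)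
    have "\<exists>y\<in>?M. y < m + e / 2"
      using cInf_lessD[OF ne, of "m + e / 2"] e(1) unfolding m_def by auto
    then obtain T where T: "S \<subseteq> T" "T \<in> lmeasurable" "?\<mu> T < m + e / 2" by auto
    obtain U0 where U0: "open U0" "T \<subseteq> U0" "U0 - T \<in> lmeasurable" "emeasure lebesgue (U0 - T) < ennreal (e / 2)"
      using sets_lebesgue_outer_open[of T "e / 2"] T(2) e(1) by auto
    define U where "U = U0 \<inter> {a<..<b}"
    have "open U" "S \<subseteq> U" using U0 T(1) S_sub by (auto simp: U_def)
    have "U \<in> lmeasurable"
    proof (rule lmeasurable_open[OF _ \<open>open U\<close>])
      show "bounded U" by (rule bounded_subset[of "{a..b}"]) (auto simp: U_def)
    qed
    have "?\<mu> U < m + e"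
    proof -
      have "?\<mu> (U0 - T) < e / 2"
        using U0(4) unfolding emeasure_eq_measure2[OF U0(3)] by (simp add: ennreal_less_iff)
      moreover have "?\<mu> U \<le> ?\<mu> (T \<union> (U0 - T))"
      proof (rule measure_mono_fmeasurable)
        show "U \<subseteq> T \<union> (U0 - T)" by (auto simp: U_def)
        show "U \<in> sets lebesgue" using \<open>U \<in> lmeasurable\<close> by (rule fmeasurableD)
        show "T \<union> (U0 - T) \<in> lmeasurable" using T(2) U0(3) by (rule fmeasurable.Un)
      qed
      moreover have "?\<mu> (T \<union> (U0 - T)) \<le> ?\<mu> T + ?\<mu> (U0 - T)"
        using T(2) U0(3) by (intro measure_Un_le fmeasurableD)
      ultimately show ?thesis using T(3) by linarith
    qed
    have ex1: "\<forall>x\<in>S. \<forall>\<epsilon>>0. \<exists>u v. u < v \<and> x \<in> {u..v} \<and> v - u < \<epsilon> \<and> {u..v} \<subseteq> U \<and> (g v - g u) / (v - u) < - r"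
    proof (intro ballI allI impI, rule slope_frequently_interval[where P = "\<lambda>q. q < - r"])
      fix x \<epsilon> :: real assume x: "x \<in> S" and "\<epsilon> > 0"
      then show "\<exists>\<^sub>F y in at x. (g y - g x) / (y - x) < - r" "\<epsilon> > 0" "open U" using \<open>open U\<close> by (simp_all add: S_def)
      show "x \<in> U" using x \<open>S \<subseteq> U\<close> by blast
    qed
    obtain \<C>1 where C1: "countable \<C>1" "disjoint \<C>1" and
      C1'': "\<forall>k\<in>\<C>1. Inf k < Sup k \<and> k = {Inf k..Sup k} \<and>
             {Inf k..Sup k} \<subseteq> U \<and> (g (Sup k) - g (Inf k)) / (Sup k - Inf k) < - r" and
      C1N: "negligible (S - \<Union>\<C>1)"
      using Vitali_covering_intervals[of S "\<lambda>u v. {u..v} \<subseteq> U \<and> (g v - g u) / (v - u) < - r", OF ex1] by (elim exE conjE)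
    note C1' = bspec[OF C1'']
    \<comment> \<open>Interiors leave room around each point for a short inner interval that stays
      inside one outer interval; the price is a countable set of end points.\<close>
    define V where "V = \<Union>(interior ` \<C>1)"
    have "V \<subseteq> U" unfolding V_def using C1' interior_subset by fast
    have "S - V \<subseteq> (S - \<Union>\<C>1) \<union> (\<Union>k\<in>\<C>1. {Inf k, Sup k})"
    proof
      fix x assume x: "x \<in> S - V"
      show "x \<in> (S - \<Union>\<C>1) \<union> (\<Union>k\<in>\<C>1. {Inf k, Sup k})"
      proof (cases "x \<in> \<Union>\<C>1")
        case True
        then obtain k where k: "k \<in> \<C>1" "x \<in> k" by blast
        then have "x \<notin> interior k" using x by (auto simp: V_def)
        moreover have "interior k = {Inf k<..<Sup k}"
          using C1'[OF k(1)] interior_atLeastAtMost_real[of "Inf k" "Sup k"] by metis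
        moreover have "x \<in> {Inf k..Sup k}" using C1'[OF k(1)] k(2) by metis
        ultimately show ?thesis using k(1) by force
      qed (use x in blast)
    qed
    moreover have "negligible (\<Union>k\<in>\<C>1. {Inf k, Sup k})"
      by (rule negligible_countable_Union) (use C1(1) in auto)
    ultimately have SV: "negligible (S - V)"
      using negligible_subset[OF negligible_Un[OF C1N]] by simp
    have ex2: "\<forall>x\<in>S \<inter> V. \<forall>\<epsilon>>0. \<exists>u v. u < v \<and> x \<in> {u..v} \<and> v - u < \<epsilon> \<and>
        ((\<exists>I\<in>\<C>1. {u..v} \<subseteq> I) \<and> (g v - g u) / (v - u) > r)"
    proof (intro ballI allI impI)
      fix x \<epsilon> :: real assume x: "x \<in> S \<inter> V" and "\<epsilon> > 0"
      obtain I where I: "I \<in> \<C>1" "x \<in> interior I" using x by (auto simp: V_def)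
      have "\<exists>\<^sub>F y in at x. r < (g y - g x) / (y - x)" using x by (simp add: S_def)
      from slope_frequently_interval[OF this open_interior I(2) \<open>\<epsilon> > 0\<close>]
      obtain u v where "u < v" "x \<in> {u..v}" "v - u < \<epsilon>" "{u..v} \<subseteq> interior I" "(g v - g u) / (v - u) > r"
        by (elim exE conjE)
      then show "\<exists>u v. u < v \<and> x \<in> {u..v} \<and> v - u < \<epsilon> \<and>
          ((\<exists>I\<in>\<C>1. {u..v} \<subseteq> I) \<and> (g v - g u) / (v - u) > r)"
        using I(1) interior_subset by blast
    qed
    obtain \<C>2 where C2: "countable \<C>2" "disjoint \<C>2" and
      C2'': "\<forall>k\<in>\<C>2. Inf k < Sup k \<and> k = {Inf k..Sup k} \<and>
        ((\<exists>I\<in>\<C>1. {Inf k..Sup k} \<subseteq> I) \<and> (g (Sup k) - g (Inf k)) / (Sup k - Inf k) > r)" and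
      C2N: "negligible (S \<inter> V - \<Union>\<C>2)"
      using Vitali_covering_intervals[of "S \<inter> V"
            "\<lambda>u v. (\<exists>I\<in>\<C>1. {u..v} \<subseteq> I) \<and> (g v - g u) / (v - u) > r", OF ex2] by (elim exE conjE)
    note C2' = bspec[OF C2'']
    have C2_lm: "k \<in> lmeasurable" if "k \<in> \<C>2" for k using C2'[OF that] by (metis lmeasurable_cbox cbox_interval)
    have C1_sub: "k \<subseteq> U" if "k \<in> \<C>1" for k using C1'[OF that] by metis
    have C2_in: "\<exists>I\<in>\<C>1. k \<subseteq> I" if "k \<in> \<C>2" for k using C2'[OF that] by metis
    have "\<Union>\<C>2 \<subseteq> U" using C2_in C1_sub by blast
    then have UC2: "\<Union>\<C>2 \<in> lmeasurable"
      using C2(1) C2_lm by (intro fmeasurableI2[OF \<open>U \<in> lmeasurable\<close>] sets.countable_Union) auto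
    have "m \<le> ?\<mu> (\<Union>\<C>2)"
    proof -
      let ?N = "(S - V) \<union> (S \<inter> V - \<Union>\<C>2)"
      have N: "negligible ?N" using SV C2N by (rule negligible_Un)
      have "m \<le> ?\<mu> (\<Union>\<C>2 \<union> ?N)"
        using UC2 negligible_imp_measurable[OF N] by (intro m_le fmeasurable.Un[of _ _ ?N]) auto
      also have "\<dots> \<le> ?\<mu> (\<Union>\<C>2) + ?\<mu> ?N"
        using UC2 negligible_imp_measurable[OF N] by (intro measure_Un_le fmeasurableD)
      finally show ?thesis using negligible_imp_measure0[OF N] by simp
    qed
    have "?\<mu> (\<Union>D) \<le> ?\<mu> U" if "D \<subseteq> \<C>2" "finite D" for D
    proof (rule measure_mono_fmeasurable)
      show "\<Union>D \<subseteq> U" using that(1) \<open>\<Union>\<C>2 \<subseteq> U\<close> by blast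
      show "\<Union>D \<in> sets lebesgue" using that C2_lm by (intro sets.finite_Union) auto
    qed (rule \<open>U \<in> lmeasurable\<close>)
    from measure_countable_Union_approachable[OF C2(1) e(1) C2_lm this]
    obtain F2 where F2: "F2 \<subseteq> \<C>2" "finite F2" "?\<mu> (\<Union>\<C>2) - e < ?\<mu> (\<Union>F2)" by blast
    obtain I where I: "\<And>J. J \<in> F2 \<Longrightarrow> I J \<in> \<C>1 \<and> J \<subseteq> I J" using C2_in F2(1) by (metis subsetD)
    define F1 where "F1 = I ` F2"
    have F1: "finite F1" "F1 \<subseteq> \<C>1" using F2(2) I by (auto simp: F1_def)
    have div1: "F1 division_of \<Union>F1"
      using C1' F1(2) by (intro disjoint_intervals_division F1(1) pairwise_subset[OF C1(2)]) blast+
    have div2: "F division_of \<Union>F" if "F \<subseteq> F2" for F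
      using C2' F2(1) that finite_subset[OF that F2(2)]
      by (intro disjoint_intervals_division pairwise_subset[OF C2(2)]) blast+
    \<comment> \<open>The chosen inner intervals inside an outer interval \<open>K\<close> are
      completed to a division of \<open>K\<close>. The pieces added here are the gaps, collected
      later in \<open>Q - F2\<close>.\<close>
    have "\<exists>q. {J \<in> F2. I J = K} \<subseteq> q \<and> q division_of K" if "K \<in> F1" for K
    proof -
      have K: "K = cbox (Inf K) (Sup K)" using C1' F1(2) that by (metis cbox_interval subsetD)
      have "\<Union>{J \<in> F2. I J = K} \<subseteq> cbox (Inf K) (Sup K)" using I K by blast
      from partial_division_extend_interval[OF div2 this] show ?thesis using K by (metis (no_types, lifting) mem_Collect_eq subsetI)
    qed
    then obtain q where q: "\<And>K. K \<in> F1 \<Longrightarrow> {J \<in> F2. I J = K} \<subseteq> q K \<and> q K division_of K" by metis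
    define Q where "Q = \<Union>(q ` F1)"
    have "F2 \<subseteq> Q" using q by (fastforce simp: Q_def F1_def)
    have disj: "K \<inter> L = {}" if "K \<in> F1" "L \<in> F1" "K \<noteq> L" for K L
      using that F1(2) C1(2) by (meson disjnt_def pairwiseD subsetD)
    have q_div: "q K division_of K" if "K \<in> F1" for K using q[OF that] by blast
    have q_el: "k \<subseteq> K" "k \<noteq> {}" "\<exists>u v. k = cbox u v" if "K \<in> F1" "k \<in> q K" for K k
      using division_ofD(2,3,4)[OF q_div[OF that(1)] that(2)] by simp_all
    have divQ: "Q division_of \<Union>F1"
    proof (rule division_ofI)
      show "finite Q" using F1(1) division_ofD(1)[OF q_div] by (auto simp: Q_def)
      have "\<Union>Q = (\<Union>K\<in>F1. \<Union>(q K))" unfolding Q_def by blast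
      then show "\<Union>Q = \<Union>F1" using division_ofD(6)[OF q_div] by simp
    next
      fix k assume "k \<in> Q"
      then obtain K where K: "K \<in> F1" "k \<in> q K" by (auto simp: Q_def)
      then show "k \<noteq> {}" "\<exists>u v. k = cbox u v" "k \<subseteq> \<Union>F1" using q_el[OF K] K(1) by blast+
      fix l assume "l \<in> Q" "k \<noteq> l"
      then obtain L where L: "L \<in> F1" "l \<in> q L" by (auto simp: Q_def)
      show "interior k \<inter> interior l = {}"
      proof (cases "K = L")
        case True
        then show ?thesis using division_ofD(5)[OF q_div[OF K(1)] K(2)] L \<open>k \<noteq> l\<close> by simp
      next
        case False
        have "k \<subseteq> K" "l \<subseteq> L" using q_el(1) K L by blast+
        then show ?thesis using disj[OF K(1) L(1) False] interior_subset by blast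
      qed
    qed
    have sumQ: "(\<Sum>k\<in>Q. h k) = (\<Sum>K\<in>F1. \<Sum>k\<in>q K. h k)" for h :: "real set \<Rightarrow> real"
      unfolding Q_def
    proof (rule sum.UNION_disjoint[OF F1(1)]; intro ballI impI)
      show "finite (q K)" if "K \<in> F1" for K using division_ofD(1)[OF q_div[OF that]] .
      fix K L assume KL: "K \<in> F1" "L \<in> F1" "K \<noteq> L"
      show "q K \<inter> q L = {}"
      proof (rule ccontr)
        assume "q K \<inter> q L \<noteq> {}"
        then obtain k where "k \<in> q K" "k \<in> q L" by blast
        then have "k \<subseteq> K" "k \<subseteq> L" "k \<noteq> {}" using q_el(1,2) KL by blast+
        then show False using disj[OF KL] by blast
      qed
    qed
    have F1': "K = {Inf K..Sup K} \<and> Inf K < Sup K" if "K \<in> F1" for K using C1' F1(2) that by blast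
    have mu1: "?\<mu> K = Sup K - Inf K" if "K \<in> F1" for K

    proof -
      have "?\<mu> {Inf K..Sup K} = Sup K - Inf K" using conjunct2[OF F1'[OF that]] by simp
      then show ?thesis using F1'[OF that] by metis
    qed
    have "(\<Sum>k\<in>Q. g (Sup k) - g (Inf k)) = (\<Sum>K\<in>F1. g (Sup K) - g (Inf K))"
      unfolding sumQ
    proof (rule sum.cong[OF refl])
      fix K assume "K \<in> F1"
      have "q K division_of {Inf K..Sup K}" using q_div[OF \<open>K \<in> F1\<close>] F1'[OF \<open>K \<in> F1\<close>] by metis
      moreover have "Inf K \<le> Sup K" using F1'[OF \<open>K \<in> F1\<close>] by linarith
      ultimately show "(\<Sum>k\<in>q K. g (Sup k) - g (Inf k)) = g (Sup K) - g (Inf K)" by (rule division_telescope)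
    qed
    have G: "Q - F2 division_of \<Union>(Q - F2)"
      using division_of_subset[of Q "Q - F2"] divQ division_ofD(6)[OF divQ] by simp
    have muQ: "(\<Sum>k\<in>Q. ?\<mu> k) = ?\<mu> (\<Union>F1)" "(\<Sum>k\<in>F1. ?\<mu> k) = ?\<mu> (\<Union>F1)" "(\<Sum>k\<in>F2. ?\<mu> k) = ?\<mu> (\<Union>F2)"
      by (rule content_division[OF divQ], rule content_division[OF div1], rule content_division[OF div2[OF subset_refl]])
    have "finite Q" by (rule division_ofD(1)[OF divQ])
    have split: "(\<Sum>k\<in>Q. h k) = (\<Sum>k\<in>F2. h k) + (\<Sum>k\<in>Q - F2. h k)" for h :: "real set \<Rightarrow> real"
      using sum.subset_diff[OF \<open>F2 \<subseteq> Q\<close> \<open>finite Q\<close>] by (simp add: add.commute)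
    have "\<Union>F1 \<subseteq> U" using C1_sub F1(2) by blast
    then have "?\<mu> (\<Union>F1) \<le> ?\<mu> U"
      by (rule measure_mono_fmeasurable[OF _ fmeasurableD[OF lmeasurable_division[OF div1]] \<open>U \<in> lmeasurable\<close>])
    then have "(\<Sum>k\<in>Q - F2. ?\<mu> k) < d"
      using split[of ?\<mu>] muQ F2(3) \<open>m \<le> ?\<mu> (\<Union>\<C>2)\<close> \<open>?\<mu> U < m + e\<close> e(2) by linarith
    moreover have "\<Union>(Q - F2) \<subseteq> {a..b}"
    proof -
      have "\<Union>(Q - F2) \<subseteq> \<Union>F1" using division_ofD(6)[OF divQ] by blast
      also have "\<dots> \<subseteq> U" by fact
      also have "U \<subseteq> {a..b}" by (auto simp: U_def)
      finally show ?thesis .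
    qed
    ultimately have "(\<Sum>k\<in>Q - F2. \<bar>g (Sup k) - g (Inf k)\<bar>) < r * m / 2" using d[OF G] by simp
    then have "(\<Sum>k\<in>Q - F2. g (Sup k) - g (Inf k)) > - (r * m / 2)"
      using sum_abs[of "\<lambda>k. g (Sup k) - g (Inf k)" "Q - F2"] by linarith
    moreover have "(\<Sum>k\<in>F2. g (Sup k) - g (Inf k)) \<ge> 0"
    proof (rule sum_nonneg)
      fix k assume "k \<in> F2"
      then have "Inf k < Sup k" "(g (Sup k) - g (Inf k)) / (Sup k - Inf k) > r"
        using C2'[OF subsetD[OF F2(1)]] by blast+
      then have "g (Sup k) - g (Inf k) > r * (Sup k - Inf k)" by (simp add: pos_less_divide_eq)
      moreover have "r * (Sup k - Inf k) > 0" using \<open>r > 0\<close> \<open>Inf k < Sup k\<close> by simp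
      ultimately show "g (Sup k) - g (Inf k) \<ge> 0" by linarith
    qed
    moreover have "(\<Sum>k\<in>F1. g (Sup k) - g (Inf k)) \<le> - (r * m / 2)"
    proof -
      have "(\<Sum>k\<in>F1. g (Sup k) - g (Inf k)) \<le> (\<Sum>k\<in>F1. - r * ?\<mu> k)"
      proof (rule sum_mono)
        fix k assume k: "k \<in> F1"
        then have "Inf k < Sup k" "(g (Sup k) - g (Inf k)) / (Sup k - Inf k) < - r"
          using C1'[OF subsetD[OF F1(2) k]] by blast+
        then show "g (Sup k) - g (Inf k) \<le> - r * ?\<mu> k"
          unfolding mu1[OF k] by (simp add: pos_divide_less_eq)
      qed
      also have "\<dots> = - r * ?\<mu> (\<Union>F1)" by (simp only: sum_distrib_left[symmetric] muQ)
      also have "\<dots> \<le> - r * (m / 2)"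
      proof (rule mult_left_mono_neg)
        have "(\<Sum>k\<in>Q - F2. ?\<mu> k) \<ge> 0" by (rule sum_nonneg) simp
        then show "m / 2 \<le> ?\<mu> (\<Union>F1)"
          using split[of ?\<mu>] muQ F2(3) \<open>m \<le> ?\<mu> (\<Union>\<C>2)\<close> e(3) by linarith
      qed (use \<open>r > 0\<close> in simp)
      finally show ?thesis by simp
    qed
    ultimately show False
      using split[of "\<lambda>k. g (Sup k) - g (Inf k)"]
        \<open>(\<Sum>k\<in>Q. g (Sup k) - g (Inf k)) = (\<Sum>K\<in>F1. g (Sup K) - g (Inf K))\<close> by linarith
  qed
  show ?thesis
    unfolding S_def[symmetric] negligible_outer_le
  proof (intro allI impI)
    fix e :: real assume "e > 0"
    then have "m < e" using \<open>m \<le> 0\<close> by simp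
    then have "\<exists>y\<in>?M. y < e" unfolding m_def by (rule cInf_lessD[OF ne])
    then show "\<exists>T. S \<subseteq> T \<and> T \<in> lmeasurable \<and> ?\<mu> T \<le> e"
      by (elim bexE CollectE exE conjE) (auto intro: less_imp_le)
  qed
qed

text \<open>On a window shorter than \<open>d\<close> the increments over disjoint intervals sum to
  less than 1, so disjoint intervals with slope of modulus above \<open>1 / e\<close> have total
  length below \<open>e\<close>. A Vitali cover by such intervals bounds the part of the set in the
  window, and negligibility is a local property.\<close>

lemma negligible_frequently_steep_slopes:
  assumes ac: "abs_continuous_on_interval a b f"
  shows "negligible {x \<in> {a<..<b}. \<forall>M. \<exists>\<^sub>F y in at x. \<bar>(f y - f x) / (y - x)\<bar> > M}"
proof -
  define S where "S = {x \<in> {a<..<b}. \<forall>M. \<exists>\<^sub>F y in at x. \<bar>(f y - f x) / (y - x)\<bar> > M}"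
  let ?\<mu> = "measure lebesgue"
  from abs_continuous_division[OF ac zero_less_one] obtain d where "d > 0" and
    d: "\<And>D S. \<lbrakk>D division_of S; S \<subseteq> {a..b}; (\<Sum>k\<in>D. ?\<mu> k) < d\<rbrakk>
         \<Longrightarrow> (\<Sum>k\<in>D. \<bar>f (Sup k) - f (Inf k)\<bar>) < 1" by blast
  have "negligible (S \<inter> {c - d / 4<..<c + d / 4})" for c
    unfolding negligible_outer_le
  proof (intro allI impI)
    fix e :: real assume "e > 0"
    define W where "W = {max a (c - d / 4)<..<min b (c + d / 4)}"
    define T where "T = S \<inter> {c - d / 4<..<c + d / 4}"
    have "T \<subseteq> W" by (auto simp: T_def W_def S_def)
    have W_lm: "W \<in> lmeasurable" by (simp add: W_def)
    have "?\<mu> W \<le> ?\<mu> {c - d / 4..c + d / 4}"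
      by (rule measure_mono_fmeasurable) (auto simp: W_def)
    also have "\<dots> < d" using \<open>d > 0\<close> by simp
    finally have "?\<mu> W < d" .
    have "W \<subseteq> {a..b}" by (auto simp: W_def)
    let ?P = "\<lambda>u v. {u..v} \<subseteq> W \<and> \<bar>(f v - f u) / (v - u)\<bar> > 1 / e"
    have ex: "\<forall>x\<in>T. \<forall>\<epsilon>>0. \<exists>u v. u < v \<and> x \<in> {u..v} \<and> v - u < \<epsilon> \<and> ?P u v"
    proof (intro ballI allI impI, rule slope_frequently_interval[where P = "\<lambda>q. \<bar>q\<bar> > 1 / e"])
      fix x \<epsilon> :: real assume x: "x \<in> T" and "\<epsilon> > 0"
      then show "\<exists>\<^sub>F y in at x. \<bar>(f y - f x) / (y - x)\<bar> > 1 / e" "\<epsilon> > 0" "open W"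
        by (simp_all add: S_def T_def W_def)
      show "x \<in> W" using x \<open>T \<subseteq> W\<close> by blast
    qed
    obtain \<C> where C: "countable \<C>" "disjoint \<C>" and
      C'': "\<forall>k\<in>\<C>. Inf k < Sup k \<and> k = {Inf k..Sup k} \<and> ?P (Inf k) (Sup k)" and
      CN: "negligible (T - \<Union>\<C>)"
      using Vitali_covering_intervals[of T ?P, OF ex] by (elim exE conjE)
    note C' = bspec[OF C'']
    have C_lm: "k \<in> lmeasurable" if "k \<in> \<C>" for k using C'[OF that] by (metis lmeasurable_cbox cbox_interval)
    have C_sub: "k \<subseteq> W" if "k \<in> \<C>" for k using C'[OF that] by metis
    have fin: "?\<mu> (\<Union>D) \<le> e" if D: "D \<subseteq> \<C>" "finite D" for D
    proof -
      have div: "D division_of \<Union>D"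
        using C' D(1) by (intro disjoint_intervals_division D(2) pairwise_subset[OF C(2)]) blast+
      have DW: "\<Union>D \<subseteq> W" using C_sub D(1) by blast
      have "?\<mu> (\<Union>D) \<le> ?\<mu> W"
        by (rule measure_mono_fmeasurable[OF DW fmeasurableD[OF lmeasurable_division[OF div]] W_lm])
      then have "(\<Sum>k\<in>D. ?\<mu> k) < d" using \<open>?\<mu> W < d\<close> unfolding content_division[OF div] by linarith
      then have lt: "(\<Sum>k\<in>D. \<bar>f (Sup k) - f (Inf k)\<bar>) < 1"
        using d[OF div] DW \<open>W \<subseteq> {a..b}\<close> by blast
      have "(\<Sum>k\<in>D. 1 / e * ?\<mu> k) \<le> (\<Sum>k\<in>D. \<bar>f (Sup k) - f (Inf k)\<bar>)"
      proof (rule sum_mono)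
        fix k assume k: "k \<in> D"
        have lt: "Inf k < Sup k" and k_eq: "k = {Inf k..Sup k}" and
          sl: "\<bar>(f (Sup k) - f (Inf k)) / (Sup k - Inf k)\<bar> > 1 / e"
          using C'[OF subsetD[OF D(1) k]] by blast+
        have "?\<mu> {Inf k..Sup k} = Sup k - Inf k" using lt by simp
        then have mu: "?\<mu> k = Sup k - Inf k" using k_eq by metis
        show "1 / e * ?\<mu> k \<le> \<bar>f (Sup k) - f (Inf k)\<bar>"
          unfolding mu using sl lt by (simp add: pos_less_divide_eq less_imp_le)
      qed
      then have "1 / e * ?\<mu> (\<Union>D) < 1"
        unfolding sum_distrib_left[symmetric] content_division[OF div] using lt by linarith
      then show ?thesis using \<open>e > 0\<close> by (simp add: field_simps)
    qed
    have "\<Union>\<C> \<subseteq> W" using C_sub by blast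
    then have UC: "\<Union>\<C> \<in> lmeasurable"
      using C(1) C_lm by (intro fmeasurableI2[OF W_lm] sets.countable_Union) auto
    have "?\<mu> (\<Union>\<C>) \<le> e"
    proof (rule ccontr)
      assume "\<not> ?thesis"
      then have "?\<mu> (\<Union>\<C>) - e > 0" by simp
      from measure_countable_Union_approachable[OF C(1) this C_lm fin]
      obtain D where "D \<subseteq> \<C>" "finite D" "?\<mu> (\<Union>\<C>) - (?\<mu> (\<Union>\<C>) - e) < ?\<mu> (\<Union>D)" by blast
      then show False using fin[of D] by simp
    qed
    moreover have "?\<mu> (\<Union>\<C> \<union> (T - \<Union>\<C>)) \<le> ?\<mu> (\<Union>\<C>) + ?\<mu> (T - \<Union>\<C>)"
      using UC negligible_imp_measurable[OF CN] by (intro measure_Un_le fmeasurableD)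
    moreover have "?\<mu> (T - \<Union>\<C>) = 0" by (rule negligible_imp_measure0[OF CN])
    moreover have "\<Union>\<C> \<union> (T - \<Union>\<C>) \<in> lmeasurable"
      by (rule fmeasurable.Un[OF UC negligible_imp_measurable[OF CN]])
    ultimately show "\<exists>T'. S \<inter> {c - d / 4<..<c + d / 4} \<subseteq> T' \<and> T' \<in> lmeasurable \<and> ?\<mu> T' \<le> e"
      unfolding T_def[symmetric] by (intro exI[of _ "\<Union>\<C> \<union> (T - \<Union>\<C>)"]) auto
  qed
  then have "negligible S"
    using \<open>d > 0\<close> unfolding locally_negligible_alt[of S]
    by (intro ballI, rule_tac x = "S \<inter> {x - d / 4<..<x + d / 4}" in exI) (auto intro: openin_open_Int)
  then show ?thesis by (simp only: S_def)
qed

text \<open>Tilting by the mean of \<open>p\<close> and \<open>q\<close> turns the two thresholds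
  into opposite numbers.\<close>

lemma negligible_frequently_distinct_slopes:
  assumes ac: "abs_continuous_on_interval a b f" and "p < q"
  shows "negligible {x \<in> {a<..<b}. (\<exists>\<^sub>F y in at x. (f y - f x) / (y - x) < p) \<and>
           (\<exists>\<^sub>F y in at x. (f y - f x) / (y - x) > q)}"
proof (rule negligible_subset)
  let ?c = "(p + q) / 2" and ?r = "(q - p) / 2"
  let ?g = "\<lambda>x. f x - ?c * x"
  show "negligible {x \<in> {a<..<b}. (\<exists>\<^sub>F y in at x. (?g y - ?g x) / (y - x) < - ?r) \<and>
           (\<exists>\<^sub>F y in at x. (?g y - ?g x) / (y - x) > ?r)}"
    using \<open>p < q\<close> by (intro negligible_frequently_opposite_slopes abs_continuous_diff_linear ac) simp
  have slope: "(?g y - ?g x) / (y - x) = (f y - f x) / (y - x) - ?c" if "y \<noteq> x" for x y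
    using that by (simp add: divide_simps) (simp add: algebra_simps)
  have ne: "\<forall>\<^sub>F y in at x. y \<noteq> x" for x :: real by (simp add: eventually_at_filter)
  have "\<exists>\<^sub>F y in at x. (?g y - ?g x) / (y - x) < - ?r" if "\<exists>\<^sub>F y in at x. (f y - f x) / (y - x) < p" for x
    using frequently_eventually_frequently[OF that ne]
  proof (rule frequently_elim1)
    fix y assume "(f y - f x) / (y - x) < p \<and> y \<noteq> x"
    then show "(?g y - ?g x) / (y - x) < - ?r" using slope[of y x] by argo
  qed
  moreover have "\<exists>\<^sub>F y in at x. (?g y - ?g x) / (y - x) > ?r" if "\<exists>\<^sub>F y in at x. (f y - f x) / (y - x) > q" for x
    using frequently_eventually_frequently[OF that ne]
  proof (rule frequently_elim1)
    fix y assume "(f y - f x) / (y - x) > q \<and> y \<noteq> x"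
    then show "(?g y - ?g x) / (y - x) > ?r" using slope[of y x] by argo
  qed
  ultimately show "{x \<in> {a<..<b}. (\<exists>\<^sub>F y in at x. (f y - f x) / (y - x) < p) \<and>
           (\<exists>\<^sub>F y in at x. (f y - f x) / (y - x) > q)} \<subseteq>
     {x \<in> {a<..<b}. (\<exists>\<^sub>F y in at x. (?g y - ?g x) / (y - x) < - ?r) \<and>
           (\<exists>\<^sub>F y in at x. (?g y - ?g x) / (y - x) > ?r)}"
    by blast
qed

text \<open>The witness \<open>L\<close> is the limit inferior. Oscillation is excluded only between
  rational thresholds, so that in the application countably many exceptional sets suffice.\<close>

lemma real_limit_exists:
  fixes g :: "'a \<Rightarrow> real"
  assumes "F \<noteq> bot"
    and bounded: "\<forall>\<^sub>F y in F. \<bar>g y\<bar> \<le> M"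
    and no_osc: "\<And>p q. \<lbrakk>p \<in> \<rat>; q \<in> \<rat>; p < q; \<exists>\<^sub>F y in F. g y < p; \<exists>\<^sub>F y in F. g y > q\<rbrakk> \<Longrightarrow> False"
  shows "\<exists>L. (g \<longlongrightarrow> L) F"
proof -
  let ?C = "{c. \<forall>\<^sub>F y in F. c \<le> g y}"
  define L where "L = Sup ?C"
  have ne: "?C \<noteq> {}"
    using bounded by (auto elim!: eventually_mono intro!: exI[of _ "- M"])
  have up: "c \<le> M" if "c \<in> ?C" for c
  proof -
    have "\<forall>\<^sub>F y in F. c \<le> M"
      using that bounded by (auto elim: eventually_elim2)
    then show ?thesis using \<open>F \<noteq> bot\<close> by (simp add: eventually_const_iff)
  qed
  have bdd: "bdd_above ?C" using up by (rule bdd_aboveI)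
  have low: "\<forall>\<^sub>F y in F. l < g y" if l: "l < L" for l
  proof -
    obtain c where c: "c \<in> ?C" "l < c" using less_cSupD[OF ne] l unfolding L_def by blast
    then have "\<forall>\<^sub>F y in F. c \<le> g y" by simp
    then show ?thesis by (rule eventually_mono) (use c(2) in simp)
  qed
  have high: "\<forall>\<^sub>F y in F. g y < u" if "L < u" for u
  proof (rule ccontr)
    assume "\<not> ?thesis"
    then have fr: "\<exists>\<^sub>F y in F. u \<le> g y" by (simp add: frequently_def not_le)
    obtain q where q: "q \<in> \<rat>" "L < q" "q < u" using Rats_dense_in_real[OF \<open>L < u\<close>] by blast
    obtain p where p: "p \<in> \<rat>" "L < p" "p < q" using Rats_dense_in_real[OF q(2)] by blast
    have "p \<notin> ?C" using cSup_upper[OF _ bdd, of p] p(2) unfolding L_def by auto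
    then have "\<exists>\<^sub>F y in F. g y < p" by (simp add: frequently_def not_less)
    moreover have "\<exists>\<^sub>F y in F. g y > q" using fr by (rule frequently_elim1) (use q in simp)
    ultimately show False using no_osc p q by blast
  qed
  show ?thesis using low high by (intro exI[of _ L] order_tendstoI)
qed

text \<open>At an interior point the derivative can fail to exist only if the difference quotients
  are unbounded or oscillate across two rationals, and each of these countably many events is
  negligible.\<close>

lemma abs_continuous_differentiable_ae:
  assumes ac: "abs_continuous_on_interval a b f"
  shows "negligible {x \<in> {a..b}. \<not> f differentiable (at x)}"
proof -
  define slope where "slope x y = (f y - f x) / (y - x)" for x y
  define B where "B p q = {x \<in> {a<..<b}. (\<exists>\<^sub>F y in at x. slope x y < p) \<and> (\<exists>\<^sub>F y in at x. slope x y > q)}" for p q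
  define U where "U = {x \<in> {a<..<b}. \<forall>M. \<exists>\<^sub>F y in at x. \<bar>slope x y\<bar> > M}"
  \<comment> \<open>The end points are added because \<open>f\<close> is arbitrary outside
    \<open>{a..b}\<close> and differentiability is two-sided.\<close>
  define N where "N = (\<Union>p\<in>\<rat>. \<Union>q\<in>\<rat> \<inter> {p<..}. B p q) \<union> U \<union> {a, b}"
  have "negligible (\<Union>q\<in>\<rat> \<inter> {p<..}. B p q)" for p
  proof (rule negligible_countable_Union)
    show "countable ((\<lambda>q. B p q) ` (\<rat> \<inter> {p<..}))" by (simp add: countable_rat)
    fix s assume "s \<in> (\<lambda>q. B p q) ` (\<rat> \<inter> {p<..})"
    then obtain q where "p < q" "s = B p q" by blast
    then show "negligible s"
      unfolding B_def slope_def by (simp only: negligible_frequently_distinct_slopes[OF ac])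
  qed
  then have "negligible (\<Union>p\<in>\<rat>. \<Union>q\<in>\<rat> \<inter> {p<..}. B p q)"
    by (intro negligible_countable_Union countable_image countable_rat) blast
  moreover have "negligible U"
    unfolding U_def slope_def by (rule negligible_frequently_steep_slopes[OF ac])
  ultimately have "negligible N" unfolding N_def by (intro negligible_Un) auto
  moreover have "{x \<in> {a..b}. \<not> f differentiable (at x)} \<subseteq> N"
  proof (rule subsetI, rule ccontr)
    fix x assume x: "x \<in> {x \<in> {a..b}. \<not> f differentiable (at x)}" and "x \<notin> N"
    then have xab: "x \<in> {a<..<b}" and "x \<notin> U" and xB: "\<And>p q. \<lbrakk>p \<in> \<rat>; q \<in> \<rat>; p < q\<rbrakk> \<Longrightarrow> x \<notin> B p q"
      by (auto simp: N_def)
    then obtain M where M: "\<not> (\<exists>\<^sub>F y in at x. \<bar>slope x y\<bar> > M)" unfolding U_def by blast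
    have "\<exists>L. (slope x \<longlongrightarrow> L) (at x)"
    proof (rule real_limit_exists)
      show "\<forall>\<^sub>F y in at x. \<bar>slope x y\<bar> \<le> M" using M by (simp add: frequently_def not_less)
      fix p q :: real
      assume "p \<in> \<rat>" "q \<in> \<rat>" "p < q" "\<exists>\<^sub>F y in at x. slope x y < p" "\<exists>\<^sub>F y in at x. slope x y > q"
      then show False using xB[of p q] xab unfolding B_def by simp
    qed simp
    then have "\<exists>L. (f has_real_derivative L) (at x)" by (simp add: has_field_derivative_iff slope_def[abs_def])
    then have "f differentiable (at x)" by (simp add: real_differentiable_def)
    then show False using x by simp
  qed
  ultimately show ?thesis by (rule negligible_subset)
qed

section \<open>The fundamental theorem of calculus for absolutely continuous functions\<close>

lemma abs_continuous_has_integral: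
  fixes f f' :: "real \<Rightarrow> real"
  assumes ac: "abs_continuous_on_interval a b f" and "a \<le> b" and N: "negligible N"
    and deriv: "\<And>x. x \<in> {a..b} - N \<Longrightarrow> (f has_vector_derivative f' x) (at x within {a..b})"
  shows "(f' has_integral (f b - f a)) {a..b}"
proof (rule has_integral_spike[OF N])
  \<comment> \<open>With value 0 on \<open>N\<close>, a tag in \<open>N\<close> contributes nothing
    to the Riemann sum, and its error is just an increment of \<open>f\<close>.\<close>
  let ?h = "\<lambda>x. if x \<in> N then 0 else f' x"
  show "f' x = ?h x" if "x \<in> {a..b} - N" for x using that by simp
  show "(?h has_integral (f b - f a)) {a..b}"
    unfolding has_integral_real
  proof (intro allI impI)
    fix e :: real assume "e > 0"
    \<comment> \<open>The summand 1 keeps the denominator positive when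
      \<open>a = b\<close>.\<close>
    define e1 where "e1 = e / (2 * (b - a + 1))"
    have "e1 > 0" using \<open>e > 0\<close> \<open>a \<le> b\<close> by (simp add: e1_def)
    have e1: "e1 * (b - a) \<le> e / 2"
    proof -
      have "e1 * (b - a) \<le> e1 * (b - a + 1)" using \<open>e1 > 0\<close> by simp
      also have "e / (2 * t) * t = e / 2" if "t \<noteq> 0" for t :: real using that by simp
      from this[of "b - a + 1"] have "e1 * (b - a + 1) = e / 2" using \<open>a \<le> b\<close> unfolding e1_def by linarith
      finally show ?thesis .
    qed
    have "e / 2 > 0" using \<open>e > 0\<close> by simp
    from abs_continuous_division[OF ac this] obtain d where "d > 0" and
      d: "\<And>D S. \<lbrakk>D division_of S; S \<subseteq> {a..b}; (\<Sum>k\<in>D. measure lebesgue k) < d\<rbrakk>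
         \<Longrightarrow> (\<Sum>k\<in>D. \<bar>f (Sup k) - f (Inf k)\<bar>) < e / 2" by blast
    have "N \<in> sets lebesgue" "N \<in> lmeasurable" "measure lebesgue N = 0"
      using negligible_imp_measurable[OF N] negligible_imp_measure0[OF N] by auto
    obtain U where U: "open U" "N \<subseteq> U" "U - N \<in> lmeasurable" "emeasure lebesgue (U - N) < ennreal d"
      using sets_lebesgue_outer_open[OF \<open>N \<in> sets lebesgue\<close> \<open>d > 0\<close>] by blast
    have "U = N \<union> (U - N)" using U(2) by blast
    then have U_lm: "U \<in> lmeasurable"
      using fmeasurable.Un[OF \<open>N \<in> lmeasurable\<close> U(3)] by simp
    have "measure lebesgue (U - N) < d"
      using U(4) unfolding emeasure_eq_measure2[OF U(3)] by (simp add: ennreal_less_iff)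
    moreover have "measure lebesgue (N \<union> (U - N)) \<le> measure lebesgue N + measure lebesgue (U - N)"
      using \<open>N \<in> sets lebesgue\<close> fmeasurableD[OF U(3)] by (rule measure_Un_le)
    ultimately have U_small: "measure lebesgue U < d"
      using \<open>U = N \<union> (U - N)\<close> \<open>measure lebesgue N = 0\<close> by simp
    have "\<exists>r>0. x \<in> {a..b} - N \<longrightarrow>
         (\<forall>y\<in>{a..b}. norm (y - x) < r \<longrightarrow> norm (f y - f x - (y - x) *\<^sub>R f' x) \<le> e1 * norm (y - x))" for x
    proof (cases "x \<in> {a..b} - N")
      case True
      then show ?thesis
        using deriv[OF True] \<open>e1 > 0\<close> unfolding has_vector_derivative_def has_derivative_within_alt by blast
    qed (auto intro: exI[of _ 1])
    then obtain r where r0: "\<And>x. r x > 0" and r: "\<And>x y. \<lbrakk>x \<in> {a..b} - N; y \<in> {a..b}; norm (y - x) < r x\<rbrakk>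
        \<Longrightarrow> norm (f y - f x - (y - x) *\<^sub>R f' x) \<le> e1 * norm (y - x)"
      by metis
    \<comment> \<open>A tag outside \<open>N\<close> gets an interval on which the derivative
      estimate holds. A tag in \<open>N\<close> has its interval confined to \<open>U\<close>, a
      neighbourhood of \<open>N\<close> of measure below \<open>d\<close>, and there absolute
      continuity controls the increments.\<close>
    let ?\<gamma> = "\<lambda>x. if x \<in> N then U else ball x (r x)"
    have g: "gauge ?\<gamma>" using U(1,2) r0 by (auto simp: gauge_def)
    have main: "norm ((\<Sum>(x, k)\<in>p. measure lborel k *\<^sub>R ?h x) - (f b - f a)) < e"
      if p: "p tagged_division_of {a..b}" and fine: "?\<gamma> fine p" for p
    proof -
      have "finite p" using p by blast
      let ?t = "\<lambda>(x, k). measure lborel k *\<^sub>R ?h x - (f (Sup k) - f (Inf k))"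
      define p1 where "p1 = {(x, k) \<in> p. x \<in> N}"
      define p2 where "p2 = p - p1"
      have "p1 \<subseteq> p" by (auto simp: p1_def)
      have "f b - f a = (\<Sum>(x, k)\<in>p. f (Sup k) - f (Inf k))"
        using additive_tagged_division_1[OF \<open>a \<le> b\<close> p, of f] by simp
      then have "(\<Sum>(x, k)\<in>p. measure lborel k *\<^sub>R ?h x) - (f b - f a) = (\<Sum>z\<in>p. ?t z)"
        by (simp add: sum_subtractf case_prod_unfold)
      also have "\<dots> = (\<Sum>z\<in>p1. ?t z) + (\<Sum>z\<in>p2. ?t z)"
        unfolding p2_def using sum.subset_diff[OF \<open>p1 \<subseteq> p\<close> \<open>finite p\<close>, of ?t] by (simp add: add.commute)
      finally have "norm ((\<Sum>(x, k)\<in>p. measure lborel k *\<^sub>R ?h x) - (f b - f a))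
          \<le> norm (\<Sum>z\<in>p1. ?t z) + norm (\<Sum>z\<in>p2. ?t z)"
        by (simp only: norm_triangle_ineq)
      moreover have "norm (\<Sum>z\<in>p1. ?t z) < e / 2"
      proof -
        have part: "p1 tagged_partial_division_of {a..b}"
          using tagged_partial_division_subset[OF _ \<open>p1 \<subseteq> p\<close>] p unfolding tagged_division_of_def by simp
        have div: "snd ` p1 division_of \<Union>(snd ` p1)" by (rule partial_division_of_tagged_division[OF part])
        have "k \<subseteq> U" "k \<subseteq> {a..b}" if "(x, k) \<in> p1" for x k
        proof -
          show "k \<subseteq> {a..b}" by (rule tagged_partial_division_ofD(3)[OF part that])
          have "x \<in> N" "(x, k) \<in> p" using that by (simp_all add: p1_def)
          then show "k \<subseteq> U" using fineD[OF fine \<open>(x, k) \<in> p\<close>] by simp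
        qed
        then have "snd z \<subseteq> U" "snd z \<subseteq> {a..b}" if "z \<in> p1" for z using that by (cases z, simp)+
        then have sub: "\<Union>(snd ` p1) \<subseteq> U" and "\<Union>(snd ` p1) \<subseteq> {a..b}" by blast+
        note this(2)
        moreover have "measure lebesgue (\<Union>(snd ` p1)) \<le> measure lebesgue U"
          by (rule measure_mono_fmeasurable[OF sub fmeasurableD[OF lmeasurable_division[OF div]] U_lm])
        then have "(\<Sum>k\<in>snd ` p1. measure lebesgue k) < d"
          using U_small unfolding content_division[OF div] by linarith
        ultimately have lt: "(\<Sum>k\<in>snd ` p1. \<bar>f (Sup k) - f (Inf k)\<bar>) < e / 2" by (rule d[OF div])
        have "norm (\<Sum>z\<in>p1. ?t z) \<le> (\<Sum>(x, k)\<in>p1. \<bar>f (Sup k) - f (Inf k)\<bar>)"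
          by (rule sum_norm_le) (auto simp: p1_def)
        also have "\<dots> = (\<Sum>k\<in>snd ` p1. \<bar>f (Sup k) - f (Inf k)\<bar>)"
        proof -
          \<comment> \<open>Passing from tagged pairs to intervals can merge pairs with different
            tags. Such an interval has empty interior, so it is a single point and its increment is
            0.\<close>
          have "(\<Sum>k\<in>snd ` p1. \<bar>f (Sup k) - f (Inf k)\<bar>) = (\<Sum>z\<in>p1. \<bar>f (Sup (snd z)) - f (Inf (snd z))\<bar>)"
          proof (rule sum.reindex_nontrivial[unfolded o_def])
            show "finite p1" using part by (rule tagged_partial_division_ofD(1))
            fix z z' assume "z \<in> p1" "z' \<in> p1" "z \<noteq> z'" "snd z = snd z'"
            then have "(fst z, snd z) \<in> p1" "(fst z', snd z) \<in> p1" "(fst z, snd z) \<noteq> (fst z', snd z)"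
              by (metis prod.collapse)+
            then have "interior (snd z) = {}" "fst z \<in> snd z" and "\<exists>u v. snd z = cbox u v"
              using tagged_partial_division_ofD(2,4,5)[OF part] by (metis Int_absorb)+
            then obtain u v where "snd z = {u..v}" "interior (snd z) = {}" "fst z \<in> snd z" by auto
            then have "snd z = {u..v}" "u = v" by auto
            then show "\<bar>f (Sup (snd z)) - f (Inf (snd z))\<bar> = 0" by simp
          qed
          then show ?thesis by (simp add: case_prod_unfold)
        qed
        finally show ?thesis using lt by simp
      qed
      moreover have "norm (\<Sum>z\<in>p2. ?t z) \<le> e / 2"
      proof -
        have "norm (\<Sum>z\<in>p2. ?t z) \<le> (\<Sum>(x, k)\<in>p2. e1 * measure lborel k)"
        proof (rule sum_norm_le, clarify)
          fix x k assume "(x, k) \<in> p2"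
          then have xk: "(x, k) \<in> p" "x \<notin> N" by (auto simp: p2_def p1_def)
          obtain u v where k: "k = {u..v}" using tagged_division_ofD(4)[OF p xk(1)] by auto
          have xk': "x \<in> k" "k \<subseteq> {a..b}" using tagged_division_ofD(2,3)[OF p xk(1)] by auto
          have "k \<subseteq> ball x (r x)" using fineD[OF fine xk(1)] xk(2) by simp
          have uv: "u \<le> x" "x \<le> v" "u \<in> {a..b}" "v \<in> {a..b}" "x \<in> {a..b} - N"
            using k xk' xk(2) by auto
          have "norm (u - x) < r x" "norm (v - x) < r x"
            using subsetD[OF \<open>k \<subseteq> ball x (r x)\<close>, of u] subsetD[OF \<open>k \<subseteq> ball x (r x)\<close>, of v] k uv(1,2)
            by (simp_all add: dist_norm norm_minus_commute)
          then have "\<bar>f u - f x - (u - x) * f' x\<bar> \<le> e1 * \<bar>u - x\<bar>" "\<bar>f v - f x - (v - x) * f' x\<bar> \<le> e1 * \<bar>v - x\<bar>"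
            using r[of x u] r[of x v] uv by simp_all
          moreover have "e1 * \<bar>u - x\<bar> + e1 * \<bar>v - x\<bar> = e1 * (v - u)" using uv by (simp add: algebra_simps)
          moreover have "(v - u) * f' x - (f v - f u) =
             (f u - f x - (u - x) * f' x) - (f v - f x - (v - x) * f' x)" by (simp add: algebra_simps)
          ultimately have "\<bar>(v - u) * f' x - (f v - f u)\<bar> \<le> e1 * (v - u)" by linarith
          then show "norm (measure lborel k *\<^sub>R ?h x - (f (Sup k) - f (Inf k))) \<le> e1 * measure lborel k"
            using uv xk(2) k by simp
        qed
        also have "\<dots> \<le> (\<Sum>(x, k)\<in>p. e1 * measure lborel k)"
          using \<open>finite p\<close> \<open>e1 > 0\<close> by (intro sum_mono2) (auto simp: p2_def)
        also have "\<dots> = e1 * (\<Sum>(x, k)\<in>p. measure lborel k)" by (simp add: sum_distrib_left case_prod_unfold)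
        also have "\<dots> = e1 * (b - a)"
          using additive_content_tagged_division[of p a b] p \<open>a \<le> b\<close> by simp
        finally show ?thesis using e1 by linarith
      qed
      ultimately show ?thesis by linarith
    qed
    show "\<exists>\<gamma>. gauge \<gamma> \<and> (\<forall>\<D>. \<D> tagged_division_of {a..b} \<and> \<gamma> fine \<D> \<longrightarrow>
        norm ((\<Sum>(x, k)\<in>\<D>. measure lborel k *\<^sub>R ?h x) - (f b - f a)) < e)"
      by (intro exI[of _ ?\<gamma>] conjI allI impI g, elim conjE, rule main)
  qed
qed

text \<open>The integrals of \<open>f'\<close> over subintervals are increments of \<open>f\<close>.
  Absolute continuity bounds their variation by 1 on intervals shorter than \<open>d\<close>, and
  these are glued by the \<open>Bolzano\<close> induction.\<close>

lemma abs_continuous_deriv_absolutely_integrable: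
  fixes f f' :: "real \<Rightarrow> real"
  assumes ac: "abs_continuous_on_interval a b f" and "a \<le> b" and N: "negligible N"
    and deriv: "\<And>x. x \<in> {a..b} - N \<Longrightarrow> (f has_vector_derivative f' x) (at x within {a..b})"
  shows "f' absolutely_integrable_on {a..b}"
proof -
  have sub: "(f' has_integral (f v - f u)) {u..v}" if "a \<le> u" "u \<le> v" "v \<le> b" for u v
  proof (rule abs_continuous_has_integral[OF _ that(2) N])
    show "abs_continuous_on_interval u v f" by (rule abs_continuous_subinterval[OF ac that(1,3)])
    show "(f has_vector_derivative f' x) (at x within {u..v})" if "x \<in> {u..v} - N" for x
      using \<open>a \<le> u\<close> \<open>v \<le> b\<close> that
      by (intro has_vector_derivative_within_subset[OF deriv[of x]]) auto
  qed
  from abs_continuous_division[OF ac zero_less_one] obtain d where "d > 0" and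
    d: "\<And>D S. \<lbrakk>D division_of S; S \<subseteq> {a..b}; (\<Sum>k\<in>D. measure lebesgue k) < d\<rbrakk>
       \<Longrightarrow> (\<Sum>k\<in>D. \<bar>f (Sup k) - f (Inf k)\<bar>) < 1" by blast
  have small: "f' absolutely_integrable_on {u..v}" if uv: "a \<le> u" "u \<le> v" "v \<le> b" "v - u < d" for u v
    unfolding box_real(2)[symmetric]
  proof (rule bounded_variation_absolutely_integrable_interval)
    show "f' integrable_on cbox u v" using sub[OF uv(1-3)] by auto
    fix D assume D: "D division_of cbox u v"
    have "(\<Sum>k\<in>D. measure lebesgue k) < d" using uv unfolding content_division[OF D] by simp
    moreover have "cbox u v \<subseteq> {a..b}" using uv by auto
    ultimately have "(\<Sum>k\<in>D. \<bar>f (Sup k) - f (Inf k)\<bar>) < 1" using d[OF D] by blast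
    moreover have "norm (integral k f') = \<bar>f (Sup k) - f (Inf k)\<bar>" if k: "k \<in> D" for k
    proof -
      obtain s t where st: "k = {s..t}" using division_ofD(4)[OF D k] by auto
      then have "s \<le> t" "u \<le> s" "t \<le> v" using division_ofD(2,3)[OF D k] by auto
      then show ?thesis using integral_unique[OF sub[of s t]] uv st by simp
    qed
    ultimately show "(\<Sum>k\<in>D. norm (integral k f')) \<le> 1" by simp
  qed
  \<comment> \<open>The intervals of the local case may stick out of \<open>{a..b}\<close>, hence
    the guards inside the induction predicate.\<close>
  have "a \<le> u \<longrightarrow> v \<le> b \<longrightarrow> u \<le> v \<longrightarrow> f' absolutely_integrable_on {u..v}" if "u \<le> v" for u v
    using that
  proof (induction u v rule: Bolzano)
    case (trans u v w)
    then show ?case using absolutely_integrable_on_combine[where f = f' and a = u and c = v and b = w] by auto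
  next
    case (local x)
    then show ?case using \<open>d > 0\<close> small by blast
  qed
  then show ?thesis using \<open>a \<le> b\<close> by blast
qed

lemma abs_continuous_imp_continuous_on:
  assumes "abs_continuous_on_interval a b f"
  shows "continuous_on {a..b} f"
  unfolding continuous_on_iff
proof (intro ballI allI impI)
  fix x e :: real assume x: "x \<in> {a..b}" and "e > 0"
  from abs_continuousE[OF assms \<open>e > 0\<close>] obtain d where "d > 0" and
    d: "\<And>D. nonoverlapping_in a b D \<Longrightarrow> (\<Sum>(u, v)\<in>D. v - u) < d \<Longrightarrow> (\<Sum>(u, v)\<in>D. \<bar>f v - f u\<bar>) < e"
    by blast
  have "dist (f y) (f x) < e" if y: "y \<in> {a..b}" "dist y x < d" for y
  proof -
    have "nonoverlapping_in a b {(min x y, max x y)}" using x y(1) by (auto simp: nonoverlapping_in_def)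
    from d[OF this] show ?thesis using y(2) by (cases "x \<le> y") (simp_all add: dist_real_def)
  qed
  then show "\<exists>d>0. \<forall>y\<in>{a..b}. dist y x < d \<longrightarrow> dist (f y) (f x) < e" using \<open>d > 0\<close> by blast
qed

text \<open>One criterion for three uses: the norm along a curve, a Lipschitz function of that norm,
  and the coordinates of a broken segment.\<close>

lemma abs_continuous_dominated:
  fixes f :: "'i \<Rightarrow> real \<Rightarrow> real"
  assumes ac: "\<And>i. i \<in> I \<Longrightarrow> abs_continuous_on_interval a b (f i)" and "finite I" "K \<ge> 0"
    and le: "\<And>u v. \<lbrakk>a \<le> u; u \<le> v; v \<le> b\<rbrakk> \<Longrightarrow> \<bar>h v - h u\<bar> \<le> K * (\<Sum>i\<in>I. \<bar>f i v - f i u\<bar>)"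
  shows "abs_continuous_on_interval a b h"
  unfolding abs_continuous_iff
proof (intro allI impI)
  fix e :: real assume "e > 0"
  \<comment> \<open>The summand 1 makes the denominator positive and the final estimate
    strict.\<close>
  define e' where "e' = e / (K * card I + 1)"
  have pos: "K * card I + 1 > 0" using \<open>K \<ge> 0\<close> by (simp add: add_nonneg_pos)
  then have "e' > 0" using \<open>e > 0\<close> by (simp add: e'_def)
  have "\<exists>d>0. \<forall>D. nonoverlapping_in a b D \<longrightarrow> (\<Sum>(u, v)\<in>D. v - u) < d \<longrightarrow> (\<Sum>(u, v)\<in>D. \<bar>f i v - f i u\<bar>) < e'"
    if "i \<in> I" for i
    using ac[OF that] \<open>e' > 0\<close> unfolding abs_continuous_iff by blast
  then obtain d where d0: "\<And>i. i \<in> I \<Longrightarrow> d i > 0" and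
    d: "\<And>i D. \<lbrakk>i \<in> I; nonoverlapping_in a b D; (\<Sum>(u, v)\<in>D. v - u) < d i\<rbrakk> \<Longrightarrow> (\<Sum>(u, v)\<in>D. \<bar>f i v - f i u\<bar>) < e'"
    by metis
  define r where "r = Min (insert 1 (d ` I))"
  have "r > 0" unfolding r_def using \<open>finite I\<close> d0 by (subst Min_gr_iff) auto
  have r_le: "r \<le> d i" if "i \<in> I" for i unfolding r_def using \<open>finite I\<close> that by (intro Min_le) auto
  have "(\<Sum>(u, v)\<in>D. \<bar>h v - h u\<bar>) < e" if D: "nonoverlapping_in a b D" "(\<Sum>(u, v)\<in>D. v - u) < r" for D
  proof -
    have "(\<Sum>(u, v)\<in>D. \<bar>h v - h u\<bar>) \<le> (\<Sum>(u, v)\<in>D. K * (\<Sum>i\<in>I. \<bar>f i v - f i u\<bar>))"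
      using nonoverlapping_in_le[OF D(1)] by (intro sum_mono) (auto intro: le)
    also have "\<dots> = K * (\<Sum>i\<in>I. \<Sum>(u, v)\<in>D. \<bar>f i v - f i u\<bar>)"
      by (subst sum.swap) (simp add: sum_distrib_left case_prod_unfold)
    also have "\<dots> \<le> K * (\<Sum>i\<in>I. e')"
    proof (intro mult_left_mono sum_mono \<open>K \<ge> 0\<close>)
      fix i assume i: "i \<in> I"
      then have "(\<Sum>(u, v)\<in>D. v - u) < d i" using D(2) r_le[OF i] by linarith
      then show "(\<Sum>(u, v)\<in>D. \<bar>f i v - f i u\<bar>) \<le> e'" using d[OF i D(1)] by simp
    qed
    also have "\<dots> = (K * card I) * e'" by simp
    also have "\<dots> < (K * card I + 1) * e'" using \<open>e' > 0\<close> by simp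
    also have "\<dots> = e" using pos by (simp add: e'_def)
    finally show ?thesis .
  qed
  then show "\<exists>d>0. \<forall>D. nonoverlapping_in a b D \<longrightarrow> (\<Sum>(u, v)\<in>D. v - u) < d \<longrightarrow> (\<Sum>(u, v)\<in>D. \<bar>h v - h u\<bar>) < e"
    using \<open>r > 0\<close> by blast
qed

section \<open>The distance formula\<close>

lemma norm_T_nonneg [simp]: "0 \<le> norm_T x"
  by (simp add: norm_T_def sum_nonneg)

lemma norm_T_zero [simp]: "norm_T 0 = 0"
  by (simp add: norm_T_def)

lemma norm_T_eq_0_iff [simp]: "norm_T x = 0 \<longleftrightarrow> x = 0"
  by (simp add: norm_T_def sum_nonneg_eq_0_iff vec_eq_iff)

lemma norm_T_scaleR: "norm_T (c *\<^sub>R x) = \<bar>c\<bar> * norm_T x"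
  by (simp add: norm_T_def abs_mult sum_distrib_left)

lemma norm_T_minus_commute: "norm_T (x - y) = norm_T (y - x)"
  by (simp add: norm_T_def abs_minus_commute)

lemma norm_T_diff_le: "\<bar>norm_T x - norm_T y\<bar> \<le> norm_T (x - y)"
proof -
  have "\<bar>norm_T x - norm_T y\<bar> = \<bar>\<Sum>i\<in>UNIV. \<bar>x $ i\<bar> - \<bar>y $ i\<bar>\<bar>"
    by (simp add: norm_T_def sum_subtractf)
  also have "\<dots> \<le> (\<Sum>i\<in>UNIV. \<bar>\<bar>x $ i\<bar> - \<bar>y $ i\<bar>\<bar>)" by (rule sum_abs)
  also have "\<dots> \<le> norm_T (x - y)"
    unfolding norm_T_def by (rule sum_mono) (simp add: abs_triangle_ineq3)
  finally show ?thesis .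
qed

lemma norm_T_diff_triangle: "norm_T (x - y) \<le> norm_T x + norm_T y"
  by (simp add: norm_T_def abs_triangle_ineq4 sum_mono flip: sum.distrib)

text \<open>\<open>g\<close> is the speed and \<open>r\<close> the rate of change of the level. The
  level is absolutely continuous because \<open>norm_T\<close> is 1-Lipschitz; so \<open>r\<close>
  comes from differentiability almost everywhere and not from a chain rule through the norm, and its
  bound by \<open>g\<close> is the limit of the same inequality for difference quotients.\<close>

lemma curve_derivatives:
  fixes \<gamma> :: "real \<Rightarrow> real ^ 'n"
  assumes \<gamma>: "\<gamma> \<in> curves_T p q"
  obtains g r N where "negligible N" "g absolutely_integrable_on {0..1}" "\<And>t. g t \<ge> 0"
    "\<And>t. t \<in> {0..1} - N \<Longrightarrow> norm_T (vector_derivative \<gamma> (at t within {0..1})) = g t"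
    "\<And>t. t \<in> {0..1} - N \<Longrightarrow> ((\<lambda>t. norm_T (\<gamma> t)) has_real_derivative r t) (at t)"
    "\<And>t. t \<in> {0..1} - N \<Longrightarrow> \<bar>r t\<bar> \<le> g t"
    "\<And>u v. \<lbrakk>0 \<le> u; u \<le> v; v \<le> 1\<rbrakk> \<Longrightarrow> norm_T (\<gamma> v - \<gamma> u) \<le> integral {u..v} g"
    "abs_continuous_on_interval 0 1 (\<lambda>t. norm_T (\<gamma> t))"
proof -
  let ?\<rho> = "\<lambda>t. norm_T (\<gamma> t)"
  have ac: "abs_continuous_on_interval 0 1 (\<lambda>t. \<gamma> t $ i)" for i using \<gamma> by (simp add: curves_T_def)
  have ac\<rho>: "abs_continuous_on_interval 0 1 ?\<rho>"
  proof (rule abs_continuous_dominated[where I = UNIV and f = "\<lambda>i t. \<gamma> t $ i" and K = 1])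
    show "\<bar>?\<rho> v - ?\<rho> u\<bar> \<le> 1 * (\<Sum>i\<in>UNIV. \<bar>\<gamma> v $ i - \<gamma> u $ i\<bar>)" for u v
      using norm_T_diff_le[of "\<gamma> v" "\<gamma> u"] by (simp add: norm_T_def)
  qed (use ac in auto)
  define N where "N = (\<Union>i. {t \<in> {0..1}. \<not> (\<lambda>t. \<gamma> t $ i) differentiable (at t)}) \<union>
    {t \<in> {0..1}. \<not> ?\<rho> differentiable (at t)}"
  \<comment> \<open>\<open>deriv\<close> also has some value on \<open>N\<close>, so
    \<open>g\<close> is a nonnegative function on the whole line that agrees with the speed off
    \<open>N\<close>.\<close>
  define G where "G i t = deriv (\<lambda>t. \<gamma> t $ i) t" for i t
  define r where "r t = deriv ?\<rho> t" for t
  define g where "g t = (\<Sum>i\<in>UNIV. \<bar>G i t\<bar>)" for t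
  have "negligible (\<Union>i. {t \<in> {0..1}. \<not> (\<lambda>t. \<gamma> t $ i) differentiable (at t)})"
    using abs_continuous_differentiable_ae[OF ac] by (intro negligible_Union finite_imageI finite) blast
  then have N: "negligible N"
    unfolding N_def by (intro negligible_Un abs_continuous_differentiable_ae ac\<rho>)
  have dG: "((\<lambda>t. \<gamma> t $ i) has_real_derivative G i t) (at t)" if "t \<in> {0..1} - N" for i t
    using that unfolding G_def DERIV_deriv_iff_real_differentiable by (auto simp: N_def)
  have dr: "(?\<rho> has_real_derivative r t) (at t)" if "t \<in> {0..1} - N" for t
    using that unfolding r_def DERIV_deriv_iff_real_differentiable by (auto simp: N_def)
  have dGv: "((\<lambda>t. \<gamma> t $ i) has_vector_derivative G i t) (at t within S)" if "t \<in> {0..1} - N" for i t S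
    using dG[OF that] has_real_derivative_iff_has_vector_derivative has_vector_derivative_at_within by blast
  have aG: "G i absolutely_integrable_on {0..1}" for i
    by (rule abs_continuous_deriv_absolutely_integrable[OF ac _ N dGv]) auto
  have ag: "g absolutely_integrable_on {0..1}"
    unfolding g_def using absolutely_integrable_norm[OF aG] by (intro absolutely_integrable_sum) (auto simp: o_def)
  have vd: "norm_T (vector_derivative \<gamma> (at t within {0..1})) = g t" if t: "t \<in> {0..1} - N" for t
  proof -
    have "(\<gamma> has_vector_derivative (\<chi> i. G i t)) (at t within {0..1})"
      unfolding has_vector_derivative_def
    proof (subst has_derivative_componentwise_within, rule ballI)
      fix b :: "real ^ 'n" assume "b \<in> Basis"
      then obtain i where b: "b = axis i 1" by (auto simp: Basis_vec_def)
      show "((\<lambda>t. \<gamma> t \<bullet> b) has_derivative (\<lambda>x. (x *\<^sub>R (\<chi> i. G i t)) \<bullet> b)) (at t within {0..1})"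
        using dGv[OF t, of i "{0..1}"] by (simp add: b inner_axis has_vector_derivative_def)
    qed
    then have "vector_derivative \<gamma> (at t within {0..1}) = (\<chi> i. G i t)"
      using t by (intro vector_derivative_within_closed_interval) auto
    then show ?thesis by (simp add: norm_T_def g_def)
  qed
  have rg: "\<bar>r t\<bar> \<le> g t" if t: "t \<in> {0..1} - N" for t
  proof (rule tendsto_le[of "at t"])
    show "((\<lambda>y. \<bar>(?\<rho> y - ?\<rho> t) / (y - t)\<bar>) \<longlongrightarrow> \<bar>r t\<bar>) (at t)"
      using dr[OF t] by (intro tendsto_rabs) (simp add: has_field_derivative_iff)
    show "((\<lambda>y. \<Sum>i\<in>UNIV. \<bar>(\<gamma> y $ i - \<gamma> t $ i) / (y - t)\<bar>) \<longlongrightarrow> g t) (at t)"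
      unfolding g_def using dG[OF t] by (intro tendsto_sum tendsto_rabs) (simp add: has_field_derivative_iff)
    have "\<bar>(?\<rho> y - ?\<rho> t) / (y - t)\<bar> \<le> (\<Sum>i\<in>UNIV. \<bar>(\<gamma> y $ i - \<gamma> t $ i) / (y - t)\<bar>)" for y
      using norm_T_diff_le[of "\<gamma> y" "\<gamma> t"]
      by (simp add: norm_T_def divide_right_mono flip: sum_divide_distrib)
    then show "\<forall>\<^sub>F y in at t. \<bar>(?\<rho> y - ?\<rho> t) / (y - t)\<bar> \<le> (\<Sum>i\<in>UNIV. \<bar>(\<gamma> y $ i - \<gamma> t $ i) / (y - t)\<bar>)"
      by simp
  qed simp
  have nd: "norm_T (\<gamma> v - \<gamma> u) \<le> integral {u..v} g" if uv: "0 \<le> u" "u \<le> v" "v \<le> 1" for u v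
  proof -
    have sub: "{u..v} \<subseteq> {0..1}" using uv by auto
    have ai: "G i absolutely_integrable_on {u..v}" for i
      using absolutely_integrable_on_subinterval[OF aG sub] .
    have hi: "(G i has_integral (\<gamma> v $ i - \<gamma> u $ i)) {u..v}" for i
    proof (rule abs_continuous_has_integral[OF _ uv(2) N])
      show "abs_continuous_on_interval u v (\<lambda>t. \<gamma> t $ i)" using abs_continuous_subinterval[OF ac uv(1,3)] .
      show "((\<lambda>t. \<gamma> t $ i) has_vector_derivative G i x) (at x within {u..v})" if "x \<in> {u..v} - N" for x
        using that sub by (intro dGv) auto
    qed
    have abs_i: "(\<lambda>t. \<bar>G i t\<bar>) integrable_on {u..v}" for i
      using absolutely_integrable_norm[OF ai[of i]] set_lebesgue_integral_eq_integral(1) by (force simp: o_def)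
    have "\<bar>\<gamma> v $ i - \<gamma> u $ i\<bar> \<le> integral {u..v} (\<lambda>t. \<bar>G i t\<bar>)" for i
      using Henstock_Kurzweil_Integration.integral_norm_bound_integral[OF has_integral_integrable[OF hi] abs_i, of i]
        integral_unique[OF hi[of i]] by simp
    then have "norm_T (\<gamma> v - \<gamma> u) \<le> (\<Sum>i\<in>UNIV. integral {u..v} (\<lambda>t. \<bar>G i t\<bar>))"
      unfolding norm_T_def by (intro sum_mono) simp
    also have "\<dots> = integral {u..v} g"
      unfolding g_def[abs_def] using abs_i by (intro integral_sum[symmetric]) auto
    finally show ?thesis .
  qed
  have "g t \<ge> 0" for t by (simp add: g_def sum_nonneg)
  then show thesis using that[OF N ag _ vd dr rg nd ac\<rho>] by blast
qed

text \<open>The last conclusion is the tool for lower bounds: a weight \<open>B'\<close> on the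
  levels is integrated along the curve through its primitive \<open>B\<close>. It is applied to
  \<open>artanh\<close> and to \<open>artanh s - c * s\<close>.\<close>

lemma length_T_eq_integral:
  fixes \<gamma> :: "real \<Rightarrow> real ^ 'n"
  assumes \<gamma>: "\<gamma> \<in> curves_T p q"
  obtains g where "(\<lambda>t. g t / (1 - (norm_T (\<gamma> t))\<^sup>2)) integrable_on {0..1}" "g integrable_on {0..1}"
    "length_T \<gamma> = integral {0..1} (\<lambda>t. g t / (1 - (norm_T (\<gamma> t))\<^sup>2))"
    "\<And>t. g t \<ge> 0" "continuous_on {0..1} (\<lambda>t. norm_T (\<gamma> t))"
    "\<And>u v. \<lbrakk>0 \<le> u; u \<le> v; v \<le> 1\<rbrakk> \<Longrightarrow> norm_T (\<gamma> v - \<gamma> u) \<le> integral {u..v} g"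
    "\<And>u v B B' h. \<lbrakk>0 \<le> u; u \<le> v; v \<le> 1; \<And>s. s \<in> {0..<1} \<Longrightarrow> (B has_real_derivative B' s) (at s);
       continuous_on {0..<1} B'; h integrable_on {u..v};
       \<And>t. t \<in> {u..v} \<Longrightarrow> \<bar>B' (norm_T (\<gamma> t))\<bar> * g t \<le> h t\<rbrakk>
       \<Longrightarrow> \<bar>B (norm_T (\<gamma> v)) - B (norm_T (\<gamma> u))\<bar> \<le> integral {u..v} h"
proof -
  let ?\<rho> = "\<lambda>t. norm_T (\<gamma> t)"
  obtain g r N where N: "negligible N" and g: "g absolutely_integrable_on {0..1}" "\<And>t. g t \<ge> 0"
    and vd: "\<And>t. t \<in> {0..1} - N \<Longrightarrow> norm_T (vector_derivative \<gamma> (at t within {0..1})) = g t"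
    and r: "\<And>t. t \<in> {0..1} - N \<Longrightarrow> (?\<rho> has_real_derivative r t) (at t)"
    and rg: "\<And>t. t \<in> {0..1} - N \<Longrightarrow> \<bar>r t\<bar> \<le> g t"
    and nd: "\<And>u v. \<lbrakk>0 \<le> u; u \<le> v; v \<le> 1\<rbrakk> \<Longrightarrow> norm_T (\<gamma> v - \<gamma> u) \<le> integral {u..v} g"
    and ac\<rho>: "abs_continuous_on_interval 0 1 ?\<rho>"
    by (rule curve_derivatives[OF \<gamma>]) blast
  have cont: "continuous_on {0..1} ?\<rho>" by (rule abs_continuous_imp_continuous_on[OF ac\<rho>])
  have \<rho>01: "?\<rho> t \<in> {0..<1}" if "t \<in> {0..1}" for t
    using \<gamma> that by (auto simp: curves_T_def ball_T_def image_subset_iff)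
  have sq: "(?\<rho> t)\<^sup>2 < 1" if "t \<in> {0..1}" for t
    using \<rho>01[OF that] by (simp add: abs_square_less_1)
  let ?w = "\<lambda>t. 1 / (1 - (?\<rho> t)\<^sup>2)"
  have cw: "continuous_on {0..1} ?w"
    using sq by (intro continuous_intros cont) (fastforce simp: less_le)
  have wg: "(\<lambda>t. ?w t * g t) absolutely_integrable_on {0..1}"
    using cw compact_imp_bounded[OF compact_continuous_image[OF cw compact_Icc]]
    by (intro absolutely_integrable_bounded_measurable_product_real g(1)
        continuous_imp_measurable_on_sets_lebesgue) auto
  then have wg': "(\<lambda>t. g t / (1 - (?\<rho> t)\<^sup>2)) absolutely_integrable_on {0..1}" by simp
  have "(\<lambda>t. norm_T (vector_derivative \<gamma> (at t within {0..1})) / (1 - (?\<rho> t)\<^sup>2)) absolutely_integrable_on {0..1}"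
    by (rule absolutely_integrable_spike[OF wg' N]) (simp add: vd)
  then have "length_T \<gamma> = integral {0..1} (\<lambda>t. norm_T (vector_derivative \<gamma> (at t within {0..1})) / (1 - (?\<rho> t)\<^sup>2))"
    unfolding length_T_def by (rule set_lebesgue_integral_eq_integral(2))
  also have "\<dots> = integral {0..1} (\<lambda>t. g t / (1 - (?\<rho> t)\<^sup>2))"
    by (rule integral_spike[OF N]) (simp add: vd)
  finally have len: "length_T \<gamma> = integral {0..1} (\<lambda>t. g t / (1 - (?\<rho> t)\<^sup>2))" .
  have main: "\<bar>B (?\<rho> v) - B (?\<rho> u)\<bar> \<le> integral {u..v} h"
    if uv: "0 \<le> u" "u \<le> v" "v \<le> 1" and B: "\<And>s. s \<in> {0..<1} \<Longrightarrow> (B has_real_derivative B' s) (at s)"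
      and B': "continuous_on {0..<1} B'" and h: "h integrable_on {u..v}"
      and le: "\<And>t. t \<in> {u..v} \<Longrightarrow> \<bar>B' (?\<rho> t)\<bar> * g t \<le> h t" for u v B B' h
  proof -
    \<comment> \<open>\<open>B'\<close> may blow up at level 1, but the curve attains a maximal
      level \<open>R < 1\<close>. On \<open>{0..R}\<close> the primitive \<open>B\<close> is
      Lipschitz, so its composition with the level is absolutely continuous.\<close>
    have "compact (?\<rho> ` {0..1})" by (rule compact_continuous_image[OF cont compact_Icc])
    then obtain R where R: "R \<in> ?\<rho> ` {0..1}" "\<And>s. s \<in> ?\<rho> ` {0..1} \<Longrightarrow> s \<le> R"
      using compact_attains_sup[of "?\<rho> ` {0..1}"] by auto
    then have "R < 1" using \<rho>01 by auto
    then have sub: "{0..R} \<subseteq> {0..<1}" by auto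
    have "bounded (B' ` {0..R})"
      by (intro compact_imp_bounded compact_continuous_image continuous_on_subset[OF B' sub] compact_Icc)
    then obtain K where K: "K > 0" "\<And>s. s \<in> {0..R} \<Longrightarrow> \<bar>B' s\<bar> \<le> K"
      unfolding bounded_pos by auto
    have ac: "abs_continuous_on_interval 0 1 (\<lambda>t. B (?\<rho> t))"
    proof (rule abs_continuous_dominated[where I = "{()}" and f = "\<lambda>_. ?\<rho>" and K = K])
      fix s t :: real assume st: "0 \<le> s" "s \<le> t" "t \<le> 1"
      have "norm (B (?\<rho> t) - B (?\<rho> s)) \<le> K * norm (?\<rho> t - ?\<rho> s)"
      proof (rule field_differentiable_bound[of "{0..R}" B B'])
        show "(B has_field_derivative B' z) (at z within {0..R})" if "z \<in> {0..R}" for z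
          using B[of z] sub that has_field_derivative_at_within by blast
        show "?\<rho> t \<in> {0..R}" "?\<rho> s \<in> {0..R}" using st R(2) by auto
      qed (use K(2) in auto)
      then show "\<bar>B (?\<rho> t) - B (?\<rho> s)\<bar> \<le> K * (\<Sum>i\<in>{()}. \<bar>?\<rho> t - ?\<rho> s\<bar>)" by simp
    qed (use K ac\<rho> in auto)
    have "((\<lambda>t. B' (?\<rho> t) * r t) has_integral (B (?\<rho> v) - B (?\<rho> u))) {u..v}"
    proof (rule abs_continuous_has_integral[OF _ uv(2) N])
      show "abs_continuous_on_interval u v (\<lambda>t. B (?\<rho> t))" by (rule abs_continuous_subinterval[OF ac uv(1,3)])
      fix t assume t: "t \<in> {u..v} - N"
      then have "t \<in> {0..1} - N" using uv by auto
      then have "((\<lambda>t. B (?\<rho> t)) has_real_derivative B' (?\<rho> t) * r t) (at t)"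
        using DERIV_chain2[OF B r] \<rho>01 by auto
      then show "((\<lambda>t. B (?\<rho> t)) has_vector_derivative B' (?\<rho> t) * r t) (at t within {u..v})"
        using has_real_derivative_iff_has_vector_derivative has_vector_derivative_at_within by blast
    qed
    \<comment> \<open>The comparison with \<open>h\<close> must hold at every point, whereas the
      bound of \<open>r\<close> by \<open>g\<close> is known only off \<open>N\<close>.\<close>
    then have hi: "((\<lambda>t. if t \<in> N then 0 else B' (?\<rho> t) * r t) has_integral (B (?\<rho> v) - B (?\<rho> u))) {u..v}"
      by (rule has_integral_spike[OF N, rotated]) simp
    have "norm (integral {u..v} (\<lambda>t. if t \<in> N then 0 else B' (?\<rho> t) * r t)) \<le> integral {u..v} h"
    proof (rule Henstock_Kurzweil_Integration.integral_norm_bound_integral[OF has_integral_integrable[OF hi] h])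
      fix t assume t: "t \<in> {u..v}"
      have "h t \<ge> 0" using le[OF t] g(2)[of t] by (meson abs_ge_zero mult_nonneg_nonneg order_trans)
      moreover have "\<bar>B' (?\<rho> t) * r t\<bar> \<le> h t" if "t \<notin> N"
      proof -
        have "\<bar>B' (?\<rho> t) * r t\<bar> \<le> \<bar>B' (?\<rho> t)\<bar> * g t"
          unfolding abs_mult using rg[of t] t uv that by (intro mult_left_mono) auto
        then show ?thesis using le[OF t] by linarith
      qed
      ultimately show "norm (if t \<in> N then 0 else B' (?\<rho> t) * r t) \<le> h t" by simp
    qed
    then show ?thesis using integral_unique[OF hi] by simp
  qed
  show thesis
    by (rule that[OF set_lebesgue_integral_eq_integral(1)[OF wg'] set_lebesgue_integral_eq_integral(1)[OF g(1)]
          len g(2) cont nd main])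
qed

text \<open>The derivative of \<open>artanh\<close> increases on \<open>[0, 1)\<close>, so the mean
  value is at most the value at the upper end. This prices the difference between the levels \<mu>
  and \<open>m\<close> in the lower bound for lengths.\<close>

lemma artanh_diff_le:
  fixes m s :: real
  assumes "0 \<le> m" "m \<le> s" "s < 1"
  shows "artanh s - artanh m \<le> (s - m) / (1 - s\<^sup>2)"
proof (cases "m = s")
  case False
  then have "m < s" using assms by simp
  then obtain z where z: "m < z" "z < s" "artanh s - artanh m = (s - m) * (1 / (1 - z\<^sup>2))"
    using MVT2[of m s artanh "\<lambda>z. 1 / (1 - z\<^sup>2)"] assms artanh_real_has_field_derivative by auto
  have "z\<^sup>2 \<le> s\<^sup>2" "s\<^sup>2 < 1" using z assms by (auto simp: abs_square_less_1 intro: power_mono)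
  then have "1 / (1 - z\<^sup>2) \<le> 1 / (1 - s\<^sup>2)" by (intro divide_left_mono) auto
  then have "(s - m) * (1 / (1 - z\<^sup>2)) \<le> (s - m) * (1 / (1 - s\<^sup>2))"
    using \<open>m < s\<close> by (intro mult_left_mono) auto
  then show ?thesis using z(3) by simp
qed simp

lemma artanh_strict_mono:
  fixes x y :: real
  assumes "-1 < x" "x < y" "y < 1"
  shows "artanh x < artanh y"
  using assms by (intro DERIV_pos_imp_increasing[of x y artanh])
    (auto intro!: exI artanh_real_has_field_derivative simp: abs_square_less_1)

text \<open>
  If the curve stays at levels at least \<open>\<mu> > m\<close>, its length is split into the flat part, at least
  \<open>c * norm_T (p - q)\<close> with \<open>c\<close> the density at level \<open>\<mu>\<close>, and the excess, whose primitive along the level is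
  \<open>artanh s - c * s\<close>.
\<close>

lemma length_T_ge:
  fixes p q :: "real ^ 'n"
  assumes \<gamma>: "\<gamma> \<in> curves_T p q"
  shows "artanh (norm_T p) + artanh (norm_T q) - 2 * artanh ((norm_T p + norm_T q - norm_T (p - q)) / 2) \<le> length_T \<gamma>"
proof -
  let ?\<rho> = "\<lambda>t. norm_T (\<gamma> t)" and ?A = "artanh :: real \<Rightarrow> real"
  \<comment> \<open>This is the norm of the meet of \<open>p\<close> and \<open>q\<close>, written
    through norms only.\<close>
  define m where "m = (norm_T p + norm_T q - norm_T (p - q)) / 2"
  obtain g where gi: "(\<lambda>t. g t / (1 - (?\<rho> t)\<^sup>2)) integrable_on {0..1}" "g integrable_on {0..1}"
    and len: "length_T \<gamma> = integral {0..1} (\<lambda>t. g t / (1 - (?\<rho> t)\<^sup>2))"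
    and g0: "\<And>t. g t \<ge> 0" and cont: "continuous_on {0..1} ?\<rho>"
    and nd: "\<And>u v. \<lbrakk>0 \<le> u; u \<le> v; v \<le> 1\<rbrakk> \<Longrightarrow> norm_T (\<gamma> v - \<gamma> u) \<le> integral {u..v} g"
    and main: "\<And>u v B B' h. \<lbrakk>0 \<le> u; u \<le> v; v \<le> 1; \<And>s. s \<in> {0..<1} \<Longrightarrow> (B has_real_derivative B' s) (at s);
       continuous_on {0..<1} B'; h integrable_on {u..v};
       \<And>t. t \<in> {u..v} \<Longrightarrow> \<bar>B' (norm_T (\<gamma> t))\<bar> * g t \<le> h t\<rbrakk>
       \<Longrightarrow> \<bar>B (norm_T (\<gamma> v)) - B (norm_T (\<gamma> u))\<bar> \<le> integral {u..v} h"
    by (rule length_T_eq_integral[OF \<gamma>]) blast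
  have ends: "\<gamma> 0 = p" "\<gamma> 1 = q" using \<gamma> by (auto simp: curves_T_def)
  have \<rho>01: "0 \<le> ?\<rho> t" "?\<rho> t < 1" if "t \<in> {0..1}" for t
    using \<gamma> that by (auto simp: curves_T_def ball_T_def image_subset_iff)
  have sq: "s\<^sup>2 < 1" if "s \<in> {0..<1}" for s :: real using that by (simp add: abs_square_less_1)
  have dA: "(?A has_real_derivative 1 / (1 - s\<^sup>2)) (at s)" if "s \<in> {0..<1}" for s
    using that by (intro artanh_real_has_field_derivative) auto
  have cA: "continuous_on {0..<1} (\<lambda>s :: real. 1 / (1 - s\<^sup>2))"
    using sq by (intro continuous_intros) (fastforce simp: less_le)
  \<comment> \<open>The curve is cut at a lowest point, so that one piece has to descend to this
    level and the other to climb from it.\<close>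
  obtain t0 where t0: "t0 \<in> {0..1}" and min: "\<And>t. t \<in> {0..1} \<Longrightarrow> ?\<rho> t0 \<le> ?\<rho> t"
    using continuous_attains_inf[OF compact_Icc _ cont] by auto
  define \<mu> where "\<mu> = ?\<rho> t0"
  have \<mu>: "0 \<le> \<mu>" "\<mu> < 1" "\<mu> \<le> norm_T p" "\<mu> \<le> norm_T q"
    using \<rho>01[OF t0] min[of 0] min[of 1] by (auto simp: \<mu>_def ends)
  have m0: "0 \<le> m" using norm_T_diff_triangle[of p q] by (simp add: m_def)
  have split: "integral {0..1} f = integral {0..t0} f + integral {t0..1} f" if "f integrable_on {0..1}" for f :: "real \<Rightarrow> real"
    using Henstock_Kurzweil_Integration.integral_combine[of 0 t0 1 f] t0 that by auto
  have sub: "f integrable_on {0..t0}" "f integrable_on {t0..1}" if "f integrable_on {0..1}" for f :: "real \<Rightarrow> real"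
    using integrable_on_subinterval[OF that] t0 by auto
  show ?thesis
  proof (cases "\<mu> \<le> m")
    \<comment> \<open>The curve dips to \<open>m\<close> or below, and the change of
      \<open>artanh\<close> along the two pieces already gives the bound.\<close>
    case True
    have le: "\<bar>1 / (1 - (?\<rho> t)\<^sup>2)\<bar> * g t \<le> g t / (1 - (?\<rho> t)\<^sup>2)" if "t \<in> {0..1}" for t
      using sq[of "?\<rho> t"] \<rho>01[OF that] by simp
    have "\<bar>?A (?\<rho> t0) - ?A (?\<rho> 0)\<bar> \<le> integral {0..t0} (\<lambda>t. g t / (1 - (?\<rho> t)\<^sup>2))"
      by (rule main[OF _ _ _ dA cA sub(1)[OF gi(1)] le]) (use t0 in auto)
    moreover have "\<bar>?A (?\<rho> 1) - ?A (?\<rho> t0)\<bar> \<le> integral {t0..1} (\<lambda>t. g t / (1 - (?\<rho> t)\<^sup>2))"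
      by (rule main[OF _ _ _ dA cA sub(2)[OF gi(1)] le]) (use t0 in auto)
    ultimately have len_ge: "?A (norm_T p) + ?A (norm_T q) - 2 * ?A \<mu> \<le> length_T \<gamma>"
      unfolding len split[OF gi(1)] by (simp add: ends \<mu>_def)
    have "norm_T p < 1" "norm_T q < 1" using \<rho>01(2)[of 0] \<rho>01(2)[of 1] by (auto simp: ends)
    moreover have "2 * m = norm_T p + norm_T q - norm_T (p - q)" by (simp add: m_def)
    ultimately have "m < 1" using norm_T_nonneg[of "p - q"] by linarith
    then have "?A \<mu> \<le> ?A m" using artanh_strict_mono[of \<mu> m] \<mu> True by (cases "\<mu> = m") auto
    then show ?thesis using len_ge unfolding m_def[symmetric] by linarith
  next
    case False
    define c where "c = 1 / (1 - \<mu>\<^sup>2)"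
    have dB: "((\<lambda>s. ?A s - c * s) has_real_derivative 1 / (1 - s\<^sup>2) - c) (at s)" if "s \<in> {0..<1}" for s
      using that by (auto intro!: derivative_eq_intros)
    have cB: "continuous_on {0..<1} (\<lambda>s :: real. 1 / (1 - s\<^sup>2) - c)"
      by (intro continuous_intros cA)
    let ?h = "\<lambda>t. g t / (1 - (?\<rho> t)\<^sup>2) - c * g t"
    have hi: "?h integrable_on {0..1}"
      by (intro integrable_diff gi integrable_on_mult_right)
    have le: "\<bar>1 / (1 - (?\<rho> t)\<^sup>2) - c\<bar> * g t \<le> ?h t" if "t \<in> {0..1}" for t
    proof -
      have "\<mu>\<^sup>2 \<le> (?\<rho> t)\<^sup>2" using min[OF that] \<mu>(1) unfolding \<mu>_def by (intro power_mono)
      moreover have "(?\<rho> t)\<^sup>2 < 1" using sq[of "?\<rho> t"] \<rho>01[OF that] by simp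
      ultimately have "c \<le> 1 / (1 - (?\<rho> t)\<^sup>2)" unfolding c_def by (intro divide_left_mono) auto
      then show ?thesis by (simp add: algebra_simps)
    qed
    let ?B = "\<lambda>s. ?A s - c * s"
    have "\<bar>?B (?\<rho> t0) - ?B (?\<rho> 0)\<bar> \<le> integral {0..t0} ?h"
      by (rule main[OF _ _ _ dB cB sub(1)[OF hi] le]) (use t0 in auto)
    moreover have "\<bar>?B (?\<rho> 1) - ?B (?\<rho> t0)\<bar> \<le> integral {t0..1} ?h"
      by (rule main[OF _ _ _ dB cB sub(2)[OF hi] le]) (use t0 in auto)
    ultimately have "?B (norm_T p) + ?B (norm_T q) - 2 * ?B \<mu> \<le> integral {0..1} ?h"
      unfolding split[OF hi] by (simp add: ends \<mu>_def)
    also have "\<dots> = length_T \<gamma> - c * integral {0..1} g"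
      unfolding len by (subst integral_diff) (auto intro: gi integrable_on_mult_right)
    also have "\<dots> \<le> length_T \<gamma> - c * norm_T (p - q)"
    proof -
      have "c \<ge> 0" using sq[of \<mu>] \<mu> by (simp add: c_def)
      then show ?thesis using nd[of 0 1] by (simp add: ends norm_T_minus_commute mult_left_mono)
    qed
    finally have "?B (norm_T p) + ?B (norm_T q) - 2 * ?B \<mu> + c * norm_T (p - q) \<le> length_T \<gamma>" by simp
    moreover have "2 * m = norm_T p + norm_T q - norm_T (p - q)" by (simp add: m_def)
    then have "c * (2 * m) = c * norm_T p + c * norm_T q - c * norm_T (p - q)"
      by (simp only: distrib_left right_diff_distrib)
    ultimately have "?A (norm_T p) + ?A (norm_T q) - 2 * ?A \<mu> + c * (2 * \<mu> - 2 * m) \<le> length_T \<gamma>"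
      by (simp add: algebra_simps)
    \<comment> \<open>Replacing \<mu> by \<open>m\<close> lowers the two \<open>artanh\<close> terms
      by no more than the surplus \<open>c * (2 * \<mu> - 2 * m)\<close> of the flat part.\<close>
    moreover have "?A \<mu> - ?A m \<le> c * (\<mu> - m)"
      using artanh_diff_le[of m \<mu>] m0 False \<mu> by (simp add: c_def)
    ultimately show ?thesis unfolding m_def[symmetric] by (simp add: algebra_simps)
  qed
qed

section \<open>The meet and the optimal curve through it\<close>

definition meet_T :: "real ^ 'n \<Rightarrow> real ^ 'n \<Rightarrow> real ^ 'n" where
  "meet_T p q = (\<chi> i. if p $ i * q $ i > 0 then sgn (p $ i) * min \<bar>p $ i\<bar> \<bar>q $ i\<bar> else 0)"

text \<open>In each coordinate the meet is the median of 0, \<open>p $ i\<close> and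
  \<open>q $ i\<close> on the real line, so it lies between any two of them.\<close>

lemma meet_T_component:
  "\<bar>p $ i\<bar> = \<bar>meet_T p q $ i\<bar> + \<bar>p $ i - meet_T p q $ i\<bar>"
  "\<bar>q $ i\<bar> = \<bar>meet_T p q $ i\<bar> + \<bar>q $ i - meet_T p q $ i\<bar>"
  "\<bar>p $ i - q $ i\<bar> = \<bar>p $ i - meet_T p q $ i\<bar> + \<bar>q $ i - meet_T p q $ i\<bar>"
  by (auto simp: meet_T_def sgn_if zero_less_mult_iff min_def abs_if not_less split: if_splits)

lemma norm_T_meet:
  "norm_T p = norm_T (meet_T p q) + norm_T (p - meet_T p q)"
  "norm_T q = norm_T (meet_T p q) + norm_T (q - meet_T p q)"
  "norm_T (p - q) = norm_T (p - meet_T p q) + norm_T (q - meet_T p q)"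
  by (simp_all add: norm_T_def meet_T_component(1)[of p _ q] meet_T_component(2)[of q _ p]
      meet_T_component(3)[of p _ q] flip: sum.distrib)

text \<open>The hypothesis places \<open>z $ i\<close> between 0 and \<open>x $ i\<close>; hence no
  coordinate changes sign on the segment and every modulus is affine along it.\<close>

lemma norm_T_segment:
  assumes "\<And>i. \<bar>x $ i\<bar> = \<bar>z $ i\<bar> + \<bar>x $ i - z $ i\<bar>" "0 \<le> s" "s \<le> 1"
  shows "norm_T (z + s *\<^sub>R (x - z)) = norm_T z + s * norm_T (x - z)"
proof -
  have "\<bar>z $ i + s * (x $ i - z $ i)\<bar> = \<bar>z $ i\<bar> + s * \<bar>x $ i - z $ i\<bar>" for i
  proof -
    have "0 \<le> z $ i \<and> 0 \<le> x $ i - z $ i \<or> z $ i \<le> 0 \<and> x $ i - z $ i \<le> 0"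
      using assms(1)[of i] by linarith
    then show ?thesis
    proof
      assume "0 \<le> z $ i \<and> 0 \<le> x $ i - z $ i"
      then show ?thesis using assms(2) by (simp add: abs_of_nonneg)
    next
      assume *: "z $ i \<le> 0 \<and> x $ i - z $ i \<le> 0"
      then have "s * (x $ i - z $ i) \<le> 0" using assms(2) by (simp add: mult_nonneg_nonpos)
      then show ?thesis using * assms(2) by (simp add: abs_of_nonpos algebra_simps)
    qed
  qed
  then show ?thesis by (simp add: norm_T_def sum.distrib sum_distrib_left)
qed

lemma abs_continuous_id: "abs_continuous_on_interval a b (\<lambda>t. t)"
proof -
  have "(\<Sum>(u, v)\<in>D. \<bar>v - u\<bar>) = (\<Sum>(u, v)\<in>D. v - u)" if "nonoverlapping_in a b D" for D
    using nonoverlapping_in_le[OF that] by (intro sum.cong) auto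
  then show ?thesis unfolding abs_continuous_iff by metis
qed

text \<open>On either leg the level changes exactly at the speed of the curve, so up to sign the
  length integrand is the derivative of \<open>artanh\<close> of the level.\<close>

lemma curve_through_meet:
  fixes p q :: "real ^ 'n"
  assumes pq: "p \<in> ball_T" "q \<in> ball_T"
  obtains \<gamma> where "\<gamma> \<in> curves_T p q"
    "length_T \<gamma> = artanh (norm_T p) + artanh (norm_T q) - 2 * artanh (norm_T (meet_T p q))"
proof -
  define z where "z = meet_T p q"
  have np: "norm_T p = norm_T z + norm_T (p - z)" and nq: "norm_T q = norm_T z + norm_T (q - z)"
    unfolding z_def by (rule norm_T_meet)+
  \<comment> \<open>The \<open>max\<close> terms put both legs into one formula; the meet is reached
    at \<open>t = 1 / 2\<close>.\<close>
  define \<gamma> where "\<gamma> t = z + max 0 (1 - 2 * t) *\<^sub>R (p - z) + max 0 (2 * t - 1) *\<^sub>R (q - z)" for t :: real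
  define \<rho> where "\<rho> t = norm_T z + max 0 (1 - 2 * t) * norm_T (p - z) + max 0 (2 * t - 1) * norm_T (q - z)" for t :: real
  have \<rho>: "norm_T (\<gamma> t) = \<rho> t" if t: "t \<in> {0..1}" for t
  proof (cases "t \<le> 1 / 2")
    case True
    then have "\<gamma> t = z + (1 - 2 * t) *\<^sub>R (p - z)" "\<rho> t = norm_T z + (1 - 2 * t) * norm_T (p - z)"
      by (simp_all add: \<gamma>_def \<rho>_def)
    then show ?thesis using norm_T_segment[of p z "1 - 2 * t"] meet_T_component(1)[of p _ q] t True
      by (simp add: z_def)
  next
    case False
    then have "\<gamma> t = z + (2 * t - 1) *\<^sub>R (q - z)" "\<rho> t = norm_T z + (2 * t - 1) * norm_T (q - z)"
      by (simp_all add: \<gamma>_def \<rho>_def)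
    then show ?thesis using norm_T_segment[of q z "2 * t - 1"] meet_T_component(2)[of q _ p] t False
      by (simp add: z_def)
  qed
  have \<rho>_ge: "0 \<le> \<rho> t" for t by (simp add: \<rho>_def)
  have \<rho>_lt: "\<rho> t < 1" if t: "t \<in> {0..1}" for t
  proof -
    have "max 0 (1 - 2 * t) * norm_T (p - z) \<le> 1 * norm_T (p - z)" "max 0 (2 * t - 1) * norm_T (q - z) \<le> 1 * norm_T (q - z)"
      using t by (intro mult_right_mono; simp)+
    moreover have "max 0 (1 - 2 * t) = 0 \<or> max 0 (2 * t - 1) = 0" by linarith
    ultimately have "\<rho> t \<le> norm_T p \<or> \<rho> t \<le> norm_T q" unfolding \<rho>_def np nq by auto
    then show ?thesis using pq by (auto simp: ball_T_def)
  qed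
  have "abs_continuous_on_interval 0 1 (\<lambda>t. \<gamma> t $ i)" for i
  proof (rule abs_continuous_dominated[where I = "{()}" and f = "\<lambda>_ t. t" and K = "2 * (\<bar>p $ i - z $ i\<bar> + \<bar>q $ i - z $ i\<bar>)"])
    fix u v :: real
    have "\<gamma> v $ i - \<gamma> u $ i = (max 0 (1 - 2 * v) - max 0 (1 - 2 * u)) * (p $ i - z $ i) +
        (max 0 (2 * v - 1) - max 0 (2 * u - 1)) * (q $ i - z $ i)"
      by (simp add: \<gamma>_def algebra_simps)
    also have "\<bar>\<dots>\<bar> \<le> \<bar>max 0 (1 - 2 * v) - max 0 (1 - 2 * u)\<bar> * \<bar>p $ i - z $ i\<bar> +
        \<bar>max 0 (2 * v - 1) - max 0 (2 * u - 1)\<bar> * \<bar>q $ i - z $ i\<bar>"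
      by (rule order_trans[OF abs_triangle_ineq]) (simp add: abs_mult)
    also have "\<dots> \<le> (2 * \<bar>v - u\<bar>) * \<bar>p $ i - z $ i\<bar> + (2 * \<bar>v - u\<bar>) * \<bar>q $ i - z $ i\<bar>"
    proof -
      have "\<bar>max 0 (1 - 2 * v) - max 0 (1 - 2 * u)\<bar> \<le> 2 * \<bar>v - u\<bar>"
        "\<bar>max 0 (2 * v - 1) - max 0 (2 * u - 1)\<bar> \<le> 2 * \<bar>v - u\<bar>" by (simp_all add: max_def abs_if)
      then show ?thesis by (intro add_mono mult_right_mono) auto
    qed
    finally show "\<bar>\<gamma> v $ i - \<gamma> u $ i\<bar> \<le> 2 * (\<bar>p $ i - z $ i\<bar> + \<bar>q $ i - z $ i\<bar>) * (\<Sum>j\<in>{()}. \<bar>v - u\<bar>)"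
      by (simp add: algebra_simps)
  qed (auto intro: abs_continuous_id)
  moreover have "\<gamma> t \<in> ball_T" if "t \<in> {0..1}" for t using \<rho>[OF that] \<rho>_lt[OF that] by (simp add: ball_T_def)
  moreover have "\<gamma> 0 = p" "\<gamma> 1 = q" by (simp_all add: \<gamma>_def)
  ultimately have in_curves: "\<gamma> \<in> curves_T p q" by (auto simp: curves_T_def)
  let ?w = "\<lambda>t. norm_T (vector_derivative \<gamma> (at t within {0..1})) / (1 - (norm_T (\<gamma> t))\<^sup>2)"
  have w: "?w t = norm_T v / (1 - (\<rho> t)\<^sup>2)" if "t \<in> {0..1}" "(\<gamma> has_vector_derivative v) (at t)" for t v
    using vector_derivative_within_closed_interval[OF zero_less_one that(1) has_vector_derivative_at_within[OF that(2)]]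
      \<rho>[OF that(1)] by simp
  have cont: "continuous_on {0..1} (\<lambda>t. artanh (\<rho> t))"
  proof (rule continuous_on_artanh')
    show "continuous_on {0..1} \<rho>" unfolding \<rho>_def[abs_def] by (intro continuous_intros)
    show "\<rho> t \<in> {-1<..<1}" if "t \<in> {0..1}" for t using \<rho>_ge[of t] \<rho>_lt[OF that] by simp
  qed
  have dA: "((\<lambda>t. artanh (\<rho> t)) has_real_derivative 1 / (1 - (\<rho> t)\<^sup>2) * r) (at t)"
    if "t \<in> {0..1}" "(\<rho> has_real_derivative r) (at t)" for t r
    using \<rho>_ge[of t] \<rho>_lt[OF that(1)] by (intro DERIV_chain2[OF _ that(2)] artanh_real_has_field_derivative) simp
  \<comment> \<open>The corner at \<open>1 / 2\<close> is an end point of both halves, so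
    derivatives are computed in the open halves only.\<close>
  have "(?w has_integral (- artanh (\<rho> (1 / 2)) - (- artanh (\<rho> 0)))) {0..1 / 2}"
  proof (rule fundamental_theorem_of_calculus_interior)
    show "continuous_on {0..1 / 2} (\<lambda>t. - artanh (\<rho> t))"
      by (intro continuous_intros continuous_on_subset[OF cont]) auto
    fix t :: real assume t: "t \<in> {0<..<1 / 2}"
    have "((\<lambda>t. z + (1 - 2 * t) *\<^sub>R (p - z)) has_vector_derivative - 2 *\<^sub>R (p - z)) (at t)"
      by (auto intro!: derivative_eq_intros)
    then have "(\<gamma> has_vector_derivative - 2 *\<^sub>R (p - z)) (at t)"
      by (rule has_vector_derivative_transform_within_open[where S = "{..<1 / 2}"]) (use t in \<open>auto simp: \<gamma>_def\<close>)
    from w[OF _ this] have w_eq: "?w t = 2 * norm_T (p - z) / (1 - (\<rho> t)\<^sup>2)"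
      using t by (simp add: norm_T_scaleR flip: scaleR_minus_left)
    have "((\<lambda>t. norm_T z + (1 - 2 * t) * norm_T (p - z)) has_real_derivative - 2 * norm_T (p - z)) (at t)"
      by (auto intro!: derivative_eq_intros)
    then have "(\<rho> has_real_derivative - 2 * norm_T (p - z)) (at t)"
      by (rule has_field_derivative_transform_within_open[where S = "{..<1 / 2}"]) (use t in \<open>auto simp: \<rho>_def\<close>)
    from dA[OF _ this] have "((\<lambda>t. - artanh (\<rho> t)) has_real_derivative ?w t) (at t)"
      using t unfolding w_eq by (auto intro!: derivative_eq_intros)
    then show "((\<lambda>t. - artanh (\<rho> t)) has_vector_derivative ?w t) (at t)"
      by (simp add: has_real_derivative_iff_has_vector_derivative)
  qed simp
  moreover have "(?w has_integral (artanh (\<rho> 1) - artanh (\<rho> (1 / 2)))) {1 / 2..1}"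
  proof (rule fundamental_theorem_of_calculus_interior)
    show "continuous_on {1 / 2..1} (\<lambda>t. artanh (\<rho> t))"
      by (intro continuous_on_subset[OF cont]) auto
    fix t :: real assume t: "t \<in> {1 / 2<..<1}"
    have "((\<lambda>t. z + (2 * t - 1) *\<^sub>R (q - z)) has_vector_derivative 2 *\<^sub>R (q - z)) (at t)"
      by (auto intro!: derivative_eq_intros)
    then have "(\<gamma> has_vector_derivative 2 *\<^sub>R (q - z)) (at t)"
      by (rule has_vector_derivative_transform_within_open[where S = "{1 / 2<..}"]) (use t in \<open>auto simp: \<gamma>_def\<close>)
    from w[OF _ this] have w_eq: "?w t = 2 * norm_T (q - z) / (1 - (\<rho> t)\<^sup>2)"
      using t by (simp add: norm_T_scaleR)
    have "((\<lambda>t. norm_T z + (2 * t - 1) * norm_T (q - z)) has_real_derivative 2 * norm_T (q - z)) (at t)"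
      by (auto intro!: derivative_eq_intros)
    then have "(\<rho> has_real_derivative 2 * norm_T (q - z)) (at t)"
      by (rule has_field_derivative_transform_within_open[where S = "{1 / 2<..}"]) (use t in \<open>auto simp: \<rho>_def\<close>)
    from dA[OF _ this] have "((\<lambda>t. artanh (\<rho> t)) has_real_derivative ?w t) (at t)"
      using t unfolding w_eq by simp
    then show "((\<lambda>t. artanh (\<rho> t)) has_vector_derivative ?w t) (at t)"
      by (simp add: has_real_derivative_iff_has_vector_derivative)
  qed simp
  ultimately have "(?w has_integral (- artanh (\<rho> (1 / 2)) - (- artanh (\<rho> 0)) + (artanh (\<rho> 1) - artanh (\<rho> (1 / 2))))) {0..1}"
    by (intro has_integral_combine[of 0 "1 / 2" 1]) auto
  then have hi: "(?w has_integral (artanh (norm_T p) + artanh (norm_T q) - 2 * artanh (norm_T z))) {0..1}"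
    by (simp add: \<rho>_def np nq)
  \<comment> \<open>\<open>length_T\<close> is a Lebesgue integral; nonnegativity upgrades the gauge
    integral just found.\<close>
  have "?w absolutely_integrable_on {0..1}"
  proof (rule nonnegative_absolutely_integrable_1)
    show "?w integrable_on {0..1}" using hi by blast
    show "0 \<le> ?w t" if "t \<in> {0..1}" for t
      using \<rho>[OF that] \<rho>_ge[of t] \<rho>_lt[OF that] by (simp add: abs_square_le_1)
  qed
  then have "length_T \<gamma> = artanh (norm_T p) + artanh (norm_T q) - 2 * artanh (norm_T z)"
    unfolding length_T_def by (simp only: set_lebesgue_integral_eq_integral(2) integral_unique[OF hi])
  then show thesis using that in_curves by (simp add: z_def)
qed

theorem dist_T_eq:
  fixes p q :: "real ^ 'n"
  assumes "p \<in> ball_T" "q \<in> ball_T"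
  shows "dist_T p q = artanh (norm_T p) + artanh (norm_T q) - 2 * artanh (norm_T (meet_T p q))"
proof -
  have m_eq: "norm_T (meet_T p q) = (norm_T p + norm_T q - norm_T (p - q)) / 2"
    using norm_T_meet(1)[of p q] norm_T_meet(2)[of q p] norm_T_meet(3)[of p q] by simp
  have ge: "artanh (norm_T p) + artanh (norm_T q) - 2 * artanh (norm_T (meet_T p q)) \<le> length_T \<gamma>"
    if "\<gamma> \<in> curves_T p q" for \<gamma> unfolding m_eq by (rule length_T_ge[OF that])
  obtain \<gamma> where \<gamma>: "\<gamma> \<in> curves_T p q"
    "length_T \<gamma> = artanh (norm_T p) + artanh (norm_T q) - 2 * artanh (norm_T (meet_T p q))"
    using curve_through_meet[OF assms] .
  show ?thesis unfolding dist_T_def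
  proof (rule antisym)
    show "(INF \<gamma>\<in>curves_T p q. length_T \<gamma>) \<le> artanh (norm_T p) + artanh (norm_T q) - 2 * artanh (norm_T (meet_T p q))"
      unfolding \<gamma>(2)[symmetric] by (intro cINF_lower \<gamma>(1) bdd_belowI2[OF ge])
    show "artanh (norm_T p) + artanh (norm_T q) - 2 * artanh (norm_T (meet_T p q)) \<le> (INF \<gamma>\<in>curves_T p q. length_T \<gamma>)"
      using \<gamma>(1) by (intro cINF_greatest ge) auto
  qed
qed

section \<open>Isometries\<close>

lemma artanh_inject:
  fixes x y :: real
  assumes "artanh x = artanh y" "-1 < x" "x < 1" "-1 < y" "y < 1"
  shows "x = y"
  using artanh_strict_mono[of x y] artanh_strict_mono[of y x] assms by (cases x y rule: linorder_cases) auto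

text \<open>Strict convexity: the mean value theorem on both halves compares the derivative at
  points on opposite sides of \<open>s\<close>. The condition \<open>h \<le> s\<close> keeps them in
  the range where the derivative increases.\<close>

lemma artanh_midpoint_less:
  fixes s h :: real
  assumes "0 < h" "h \<le> s" "s + h < 1"
  shows "2 * artanh s < artanh (s + h) + artanh (s - h)"
proof -
  have mvt: "\<exists>z>u. z < v \<and> artanh v - artanh u = (v - u) * (1 / (1 - z\<^sup>2))" if "-1 < u" "u < v" "v < 1" for u v :: real
    by (rule MVT2[OF that(2)]) (use that in \<open>auto intro!: artanh_real_has_field_derivative\<close>)
  obtain z1 where z1: "s < z1" "z1 < s + h" "artanh (s + h) - artanh s = h * (1 / (1 - z1\<^sup>2))"
    using mvt[of s "s + h"] assms by auto
  obtain z2 where z2: "s - h < z2" "z2 < s" "artanh s - artanh (s - h) = h * (1 / (1 - z2\<^sup>2))"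
    using mvt[of "s - h" s] assms by auto
  have "z2\<^sup>2 < z1\<^sup>2" using z1 z2 assms by (intro power_strict_mono) auto
  moreover have "z1\<^sup>2 < 1" using z1 z2 assms by (simp add: abs_square_less_1)
  ultimately have "h * (1 / (1 - z2\<^sup>2)) < h * (1 / (1 - z1\<^sup>2))"
    using \<open>0 < h\<close> by (intro mult_strict_left_mono divide_strict_left_mono) auto
  then show ?thesis using z1(3) z2(3) by linarith
qed

lemma norm_T_meet_T: "norm_T (meet_T p q) = (\<Sum>i\<in>UNIV. if p $ i * q $ i > 0 then min \<bar>p $ i\<bar> \<bar>q $ i\<bar> else 0)"
  unfolding norm_T_def by (rule sum.cong) (auto simp: meet_T_def abs_mult sgn_if)

lemma norm_T_meet_T_eq: "norm_T (meet_T p q) = (norm_T p + norm_T q - norm_T (p - q)) / 2"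
  using norm_T_meet(1)[of p q] norm_T_meet(2)[of q p] norm_T_meet(3)[of p q] by simp

lemma norm_T_meet_T_le: "norm_T (meet_T p q) \<le> norm_T p" "norm_T (meet_T p q) \<le> norm_T q"
  using norm_T_meet(1)[of p q] norm_T_meet(2)[of q p] norm_T_nonneg[of "p - meet_T p q"] norm_T_nonneg[of "q - meet_T p q"]
  by linarith+

lemma norm_T_meet_T_0 [simp]: "norm_T (meet_T 0 q) = 0" "norm_T (meet_T p 0) = 0"
  by (simp_all add: norm_T_meet_T)

lemma norm_T_meet_T_absorb:
  "norm_T (meet_T (meet_T p q) p) = norm_T (meet_T p q)" "norm_T (meet_T p (meet_T p q)) = norm_T (meet_T p q)"
  "norm_T (meet_T (meet_T p q) q) = norm_T (meet_T p q)" "norm_T (meet_T q (meet_T p q)) = norm_T (meet_T p q)"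
  using norm_T_meet(1)[of p q] norm_T_meet(2)[of q p] norm_T_minus_commute[of p "meet_T p q"] norm_T_minus_commute[of q "meet_T p q"]
  unfolding norm_T_meet_T_eq[of "meet_T p q" p] norm_T_meet_T_eq[of p "meet_T p q"]
    norm_T_meet_T_eq[of "meet_T p q" q] norm_T_meet_T_eq[of q "meet_T p q"] by simp_all

lemma norm_T_meet_T_eq_norm_imp_le:
  assumes "norm_T (meet_T p q) = norm_T p"
  shows "\<bar>p $ i\<bar> \<le> \<bar>q $ i\<bar>"
proof -
  have "p = meet_T p q" using norm_T_meet(1)[of p q] assms by simp
  then show ?thesis using meet_T_component(2)[of q i p] by simp
qed

lemma component_le_norm_T: "\<bar>x $ i\<bar> \<le> norm_T x"
  unfolding norm_T_def by (rule member_le_sum) auto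

lemma norm_T_add_axis: "norm_T (x + axis i c) = norm_T x - \<bar>x $ i\<bar> + \<bar>x $ i + c\<bar>"
proof -
  have "norm_T (x + axis i c) = \<bar>x $ i + c\<bar> + (\<Sum>k\<in>UNIV - {i}. \<bar>x $ k\<bar>)"
    unfolding norm_T_def by (subst sum.remove[of _ i]) (auto simp: axis_def intro!: sum.cong)
  also have "(\<Sum>k\<in>UNIV - {i}. \<bar>x $ k\<bar>) = norm_T x - \<bar>x $ i\<bar>"
    unfolding norm_T_def by (subst sum.remove[of UNIV i]) auto
  finally show ?thesis by simp
qed

lemma norm_T_axis [simp]: "norm_T (axis i c) = \<bar>c\<bar>"
  using norm_T_add_axis[of 0 i c] by simp

section \<open>Medians and the origin\<close>

definition between_T :: "real ^ 'n \<Rightarrow> real ^ 'n \<Rightarrow> real ^ 'n \<Rightarrow> bool" where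
  "between_T x z y \<longleftrightarrow> dist_T x z + dist_T z y = dist_T x y"

definition has_medians_T :: "real ^ 'n \<Rightarrow> bool" where
  "has_medians_T x \<longleftrightarrow> (\<forall>a\<in>ball_T. \<forall>b\<in>ball_T. \<exists>c\<in>ball_T. between_T x c a \<and> between_T x c b \<and> between_T a c b)"

lemma zero_in_ball_T [simp]: "0 \<in> ball_T"
  by (simp add: ball_T_def)

text \<open>The meet of \<open>a\<close> and \<open>b\<close> is the median: it lies below both, and
  the optimal curve from \<open>a\<close> to \<open>b\<close> runs through it.\<close>

lemma has_medians_T_0: "has_medians_T 0"
  unfolding has_medians_T_def
proof (intro ballI)
  fix a b :: "real ^ 'n" assume ab: "a \<in> ball_T" "b \<in> ball_T"
  have c: "meet_T a b \<in> ball_T" using ab(1) norm_T_meet_T_le(1)[of a b] by (simp add: ball_T_def)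
  show "\<exists>c\<in>ball_T. between_T 0 c a \<and> between_T 0 c b \<and> between_T a c b"
    by (rule bexI[OF _ c]) (simp add: between_T_def dist_T_eq ab c norm_T_meet_T_absorb)
qed

text \<open>Think of \<open>norm_T (meet_T x b) = norm_T x\<close> as \<open>x\<close> lying below
  \<open>b\<close>. Then a point between them in the metric is between them in this order: the
  distance formula reduces betweenness to an equality of two sums whose terms are ordered one by
  one.\<close>

lemma between_T_comparable:
  assumes "between_T x c b" "norm_T (meet_T x b) = norm_T x" and ball: "x \<in> ball_T" "c \<in> ball_T" "b \<in> ball_T"
  shows "norm_T (meet_T x c) = norm_T x" "norm_T (meet_T c b) = norm_T c"
proof -
  have lt: "norm_T x < 1" "norm_T c < 1" using ball by (auto simp: ball_T_def)
  have mono: "artanh u \<le> artanh v" if "0 \<le> u" "u \<le> v" "v < 1" for u v :: real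
    using artanh_strict_mono[of u v] that by (cases "u = v") auto
  have "artanh (norm_T (meet_T x c)) \<le> artanh (norm_T x)" "artanh (norm_T (meet_T c b)) \<le> artanh (norm_T c)"
    using norm_T_meet_T_le(1) lt by (auto intro!: mono)
  moreover have "artanh (norm_T x) + artanh (norm_T c) = artanh (norm_T (meet_T x c)) + artanh (norm_T (meet_T c b))"
    using assms(1,2) unfolding between_T_def dist_T_eq[OF ball(1,2)] dist_T_eq[OF ball(2,3)] dist_T_eq[OF ball(1,3)]
    by simp
  ultimately have "artanh (norm_T (meet_T x c)) = artanh (norm_T x)" "artanh (norm_T (meet_T c b)) = artanh (norm_T c)"
    by linarith+
  moreover have "-1 < norm_T v" for v :: "real ^ 'a" using norm_T_nonneg[of v] by linarith
  moreover have "norm_T (meet_T x c) < 1" "norm_T (meet_T c b) < 1"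
    using norm_T_meet_T_le(1)[of x c] norm_T_meet_T_le(1)[of c b] lt by linarith+
  ultimately show "norm_T (meet_T x c) = norm_T x" "norm_T (meet_T c b) = norm_T c"
    using lt by (auto intro!: artanh_inject)
qed

text \<open>
  The point \<open>b\<close> lies beyond \<open>x\<close> in the direction of the \<open>j\<close>-th coordinate, and \<open>a\<close> is \<open>b\<close> with its \<open>i\<close>-th
  coordinate moved towards \<open>0\<close>.  The median of \<open>x\<close>, \<open>a\<close>, \<open>b\<close> would have to be as far out as \<open>b\<close>, but the
  route from \<open>x\<close> to \<open>a\<close> over that level is too long because \<open>artanh\<close> is strictly convex.
\<close>

lemma not_has_medians_T:
  fixes x :: "real ^ 'n"
  assumes "CARD('n) \<ge> 2" "x \<in> ball_T" "x \<noteq> 0"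
  shows "\<not> has_medians_T x"
proof
  assume med: "has_medians_T x"
  obtain i where i: "x $ i \<noteq> 0" using \<open>x \<noteq> 0\<close> by (auto simp: vec_eq_iff)
  obtain j where j: "j \<noteq> i"
    using assms(1) card_le_Suc0_iff_eq[of "UNIV :: 'n set"] by (metis UNIV_I finite not_less_eq_eq numeral_2_eq_2)
  define s where "s = norm_T x"
  have "s < 1" using assms(2) by (simp add: s_def ball_T_def)
  \<comment> \<open>The first bound keeps the \<open>i\<close>-th coordinate from overshooting 0,
    the second keeps \<open>b\<close> in the ball.\<close>
  define h where "h = min \<bar>x $ i\<bar> ((1 - s) / 2)"
  have h: "0 < h" "h \<le> \<bar>x $ i\<bar>" "s + h < 1" using i \<open>s < 1\<close> by (auto simp: h_def min_def field_simps)
  have "h \<le> s" using h(2) component_le_norm_T[of x i] by (simp add: s_def)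
  define \<sigma> where "\<sigma> = (if x $ j \<ge> 0 then h else - h)"
  define \<tau> where "\<tau> = (if x $ i \<ge> 0 then - h else h)"
  define b where "b = x + axis j \<sigma>"
  define a where "a = b + axis i \<tau>"
  have sb: "norm_T b = s + h"
    unfolding b_def norm_T_add_axis s_def using h(1) by (simp add: \<sigma>_def)
  have bi: "b $ i = x $ i" using j by (simp add: b_def axis_def)
  have sa: "norm_T a = s"
    unfolding a_def norm_T_add_axis sb bi using h(1,2) by (simp add: \<tau>_def)
  have "b - x = axis j \<sigma>" by (simp add: b_def)
  then have xb: "norm_T (x - b) = h" using h(1) by (subst norm_T_minus_commute) (simp add: \<sigma>_def)
  have ab: "norm_T (a - b) = h" using h(1) by (simp add: a_def \<tau>_def)
  have "a - x = axis j \<sigma> + axis i \<tau>" by (simp add: a_def b_def)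
  then have xa: "norm_T (x - a) = 2 * h"
  proof (subst norm_T_minus_commute)
    have "axis j \<sigma> $ i = 0" using j by (simp add: axis_def)
    then show "norm_T (a - x) = 2 * h"
      unfolding \<open>a - x = axis j \<sigma> + axis i \<tau>\<close> norm_T_add_axis using h(1) by (simp add: \<sigma>_def \<tau>_def)
  qed
  have mxb: "norm_T (meet_T x b) = s" and mab: "norm_T (meet_T a b) = s" and mxa: "norm_T (meet_T x a) = s - h"
    unfolding norm_T_meet_T_eq xb ab xa sb sa s_def[symmetric] by simp_all
  have ball: "x \<in> ball_T" "a \<in> ball_T" "b \<in> ball_T"
    using assms(2) sa sb h(3) \<open>s < 1\<close> by (auto simp: ball_T_def)
  obtain c where c: "c \<in> ball_T" "between_T x c a" "between_T x c b" "between_T a c b"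
    using med ball unfolding has_medians_T_def by blast
  have mxc: "norm_T (meet_T x c) = s" and mcb: "norm_T (meet_T c b) = norm_T c"
    using between_T_comparable[OF c(3) _ ball(1) c(1) ball(3)] mxb by (simp_all add: s_def)
  have mac: "norm_T (meet_T a c) = s"
    using between_T_comparable(1)[OF c(4) _ ball(2) c(1) ball(3)] mab sa by simp
  \<comment> \<open>\<open>c\<close> dominates both \<open>x\<close> and \<open>a\<close>, and every
    coordinate of \<open>b\<close> is taken from one of them: the \<open>j\<close>-th from
    \<open>a\<close>, the others from \<open>x\<close>.\<close>
  have "\<bar>b $ k\<bar> \<le> \<bar>c $ k\<bar>" for k
  proof (cases "k = j")
    case True
    then have "b $ k = a $ k" using j by (simp add: a_def axis_def)
    then show ?thesis using norm_T_meet_T_eq_norm_imp_le[of a c k] mac sa by simp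
  next
    case False
    then have "b $ k = x $ k" by (simp add: b_def axis_def)
    then show ?thesis using norm_T_meet_T_eq_norm_imp_le[of x c k] mxc by (simp add: s_def)
  qed
  then have "norm_T b \<le> norm_T c" unfolding norm_T_def by (intro sum_mono)
  moreover have "norm_T c \<le> norm_T b" using norm_T_meet_T_le(2)[of c b] mcb by simp
  ultimately have sc: "norm_T c = s + h" using sb by simp
  have mca: "norm_T (meet_T c a) = s"
    using mac unfolding norm_T_meet_T_eq by (simp add: norm_T_minus_commute add.commute)
  \<comment> \<open>This is the betweenness of \<open>c\<close> with respect to \<open>x\<close> and
    \<open>a\<close>, after inserting all levels into the distance formula.\<close>
  have "artanh (s + h) + artanh (s - h) = 2 * artanh s"
    using c(2) unfolding between_T_def dist_T_eq[OF ball(1) c(1)] dist_T_eq[OF c(1) ball(2)] dist_T_eq[OF ball(1,2)]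
    by (simp add: sc sa mxc mca mxa s_def[symmetric])
  then show False using artanh_midpoint_less[OF h(1) \<open>h \<le> s\<close> h(3)] by simp
qed

lemma isometry_fixes_0:
  fixes f :: "real ^ 'n \<Rightarrow> real ^ 'n"
  assumes "CARD('n) \<ge> 2" and bij: "bij_betw f ball_T ball_T"
    and iso: "\<And>x y. \<lbrakk>x \<in> ball_T; y \<in> ball_T\<rbrakk> \<Longrightarrow> dist_T (f x) (f y) = dist_T x y"
  shows "f 0 = 0"
proof (rule ccontr)
  have ball: "f x \<in> ball_T" if "x \<in> ball_T" for x using bij that by (auto simp: bij_betw_def)
  have surj: "\<exists>x\<in>ball_T. f x = y" if "y \<in> ball_T" for y
    using bij_betw_imp_surj_on[OF bij] that by (metis imageE)
  have "has_medians_T (f 0)"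
    unfolding has_medians_T_def
  proof (intro ballI)
    fix a b :: "real ^ 'n" assume "a \<in> ball_T" "b \<in> ball_T"
    then obtain a' b' where ab': "a' \<in> ball_T" "b' \<in> ball_T" "a = f a'" "b = f b'" using surj by metis
    then obtain c where "c \<in> ball_T" "between_T 0 c a'" "between_T 0 c b'" "between_T a' c b'"
      using has_medians_T_0 unfolding has_medians_T_def by blast
    then show "\<exists>c\<in>ball_T. between_T (f 0) c a \<and> between_T (f 0) c b \<and> between_T a c b"
      using ab' ball iso by (intro bexI[of _ "f c"]) (auto simp: between_T_def)
  qed
  moreover assume "f 0 \<noteq> 0"
  ultimately show False using not_has_medians_T[OF assms(1) ball[OF zero_in_ball_T]] by blast
qed

section \<open>Half-axes and the recovery of coordinates\<close>

lemma meet_T_axis: "norm_T (meet_T p (axis i c)) = (if p $ i * c > 0 then min \<bar>p $ i\<bar> \<bar>c\<bar> else 0)"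
proof -
  have "norm_T (meet_T p (axis i c)) = (\<Sum>k\<in>UNIV. if k = i then if p $ i * c > 0 then min \<bar>p $ i\<bar> \<bar>c\<bar> else 0 else 0)"
    unfolding norm_T_meet_T by (rule sum.cong) (auto simp: axis_def)
  then show ?thesis by simp
qed

lemma norm_T_meet_T_eq_0_iff: "norm_T (meet_T p q) = 0 \<longleftrightarrow> (\<forall>i. p $ i * q $ i \<le> 0)"
proof -
  have "(if u * v > 0 then min \<bar>u\<bar> \<bar>v\<bar> else 0) = 0 \<longleftrightarrow> u * v \<le> 0" for u v :: real
    by (cases "u = 0"; cases "v = 0") (auto simp: min_def not_less)
  then show ?thesis
    unfolding norm_T_meet_T by (subst sum_nonneg_eq_0_iff) auto
qed

text \<open>Meeting an axis point fixes the sign of one coordinate, so two points that meet it also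
  meet each other. A point with two nonzero coordinates meets its projections to both axes, and
  these do not meet each other. The origin counts as an axis point, with
  \<open>c = 0\<close>.\<close>

lemma is_axis_iff:
  fixes p :: "real ^ 'n"
  assumes "p \<in> ball_T"
  shows "(\<exists>i c. p = axis i c) \<longleftrightarrow> (\<forall>q\<in>ball_T. \<forall>r\<in>ball_T. norm_T (meet_T q r) = 0 \<longrightarrow>
    norm_T (meet_T q p) = 0 \<or> norm_T (meet_T r p) = 0)" (is "?L \<longleftrightarrow> ?R")
proof
  assume ?L
  then obtain i c where p: "p = axis i c" by blast
  show ?R
  proof (intro ballI impI, rule ccontr)
    fix q r :: "real ^ 'n"
    assume qr: "norm_T (meet_T q r) = 0" and "\<not> (norm_T (meet_T q p) = 0 \<or> norm_T (meet_T r p) = 0)"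
    then have "q $ i * c > 0" "r $ i * c > 0" unfolding p meet_T_axis by (auto split: if_splits)
    then have "q $ i * r $ i > 0" by (auto simp: zero_less_mult_iff)
    then show False using qr unfolding norm_T_meet_T_eq_0_iff by (meson not_less)
  qed
next
  assume R: ?R
  show ?L
  proof (rule ccontr)
    assume not: "\<not> ?L"
    obtain i where i: "p $ i \<noteq> 0"
    proof -
      have "p \<noteq> 0" using not by (metis axis_eq_0_iff)
      then show thesis using that by (auto simp: vec_eq_iff)
    qed
    obtain j where j: "j \<noteq> i" "p $ j \<noteq> 0"
    proof -
      have "p \<noteq> axis i (p $ i)" using not by blast
      then show thesis using that by (auto simp: vec_eq_iff axis_def split: if_splits)
    qed
    let ?q = "axis i (p $ i) :: real ^ 'n" and ?r = "axis j (p $ j) :: real ^ 'n"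
    have "?q \<in> ball_T" "?r \<in> ball_T"
      using assms component_le_norm_T[of p i] component_le_norm_T[of p j] by (auto simp: ball_T_def)
    moreover have "norm_T (meet_T ?q ?r) = 0" using j unfolding meet_T_axis by (simp add: axis_def)
    moreover have "norm_T (meet_T ?q p) \<noteq> 0"
      unfolding norm_T_meet_T_eq_0_iff not_all using i by (intro exI[of _ i]) (auto simp: axis_def zero_less_mult_iff not_le linorder_neq_iff)
    moreover have "norm_T (meet_T ?r p) \<noteq> 0"
      unfolding norm_T_meet_T_eq_0_iff not_all using j by (intro exI[of _ j]) (auto simp: axis_def zero_less_mult_iff not_le linorder_neq_iff)
    ultimately show False using R by blast
  qed
qed

text \<open>Once \<open>f 0 = 0\<close>, the distance formula yields preservation of the norm and
  then of the norm of meets. The rest of the argument uses only these facts and bijectivity.\<close>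

lemma isometry_is_signed_perm:
  fixes f :: "real ^ 'n \<Rightarrow> real ^ 'n"
  assumes "CARD('n) \<ge> 2" and bij: "bij_betw f ball_T ball_T"
    and iso: "\<And>x y. \<lbrakk>x \<in> ball_T; y \<in> ball_T\<rbrakk> \<Longrightarrow> dist_T (f x) (f y) = dist_T x y"
  obtains s \<sigma> where "range s \<subseteq> {- 1, 1}" "bij \<sigma>" "\<And>x. x \<in> ball_T \<Longrightarrow> f x = signed_perm s \<sigma> x"
proof -
  let ?M = "\<lambda>p q :: real ^ 'n. norm_T (meet_T p q)"
  have ball: "f x \<in> ball_T" if "x \<in> ball_T" for x using bij that by (auto simp: bij_betw_def)
  have surj: "\<exists>x\<in>ball_T. f x = y" if "y \<in> ball_T" for y
    using bij_betw_imp_surj_on[OF bij] that by (metis imageE)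
  have inj: "x = y" if "f x = f y" "x \<in> ball_T" "y \<in> ball_T" for x y
    using bij_betw_imp_inj_on[OF bij] that by (meson inj_onD)
  have f0: "f 0 = 0" by (rule isometry_fixes_0[OF assms])
  have lt1: "norm_T x < 1" if "x \<in> ball_T" for x :: "real ^ 'n" using that by (simp add: ball_T_def)
  have gt: "-1 < norm_T x" for x :: "real ^ 'n" using norm_T_nonneg[of x] by linarith
  have norm_f: "norm_T (f x) = norm_T x" if x: "x \<in> ball_T" for x
  proof (rule artanh_inject)
    show "artanh (norm_T (f x)) = artanh (norm_T x)"
      using iso[OF zero_in_ball_T x] x ball[OF x] by (simp add: f0 dist_T_eq)
  qed (use lt1 gt x ball in auto)
  have meet_f: "?M (f x) (f y) = ?M x y" if x: "x \<in> ball_T" and y: "y \<in> ball_T" for x y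
  proof (rule artanh_inject)
    show "artanh (?M (f x) (f y)) = artanh (?M x y)"
      using iso[OF x y] x y ball by (simp add: dist_T_eq norm_f)
    show "?M (f x) (f y) < 1" "?M x y < 1"
      using norm_T_meet_T_le(1)[of "f x" "f y"] norm_T_meet_T_le(1)[of x y] lt1[OF x] lt1[OF ball[OF x]] by linarith+
  qed (rule gt)+
  have axis_ball: "axis i v \<in> ball_T \<longleftrightarrow> \<bar>v\<bar> < 1" for i :: 'n and v by (simp add: ball_T_def)
  have axis_f: "\<exists>k d. f p = axis k d" if p: "p \<in> ball_T" and ax: "\<exists>i c. p = axis i c" for p
    unfolding is_axis_iff[OF ball[OF p]]
  proof (intro ballI impI)
    fix q r assume qr: "q \<in> ball_T" "r \<in> ball_T" "?M q r = 0"
    then obtain q' r' where q'r': "q' \<in> ball_T" "r' \<in> ball_T" "q = f q'" "r = f r'" using surj by metis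
    then have "?M q' r' = 0" using qr(3) meet_f by metis
    then have "?M q' p = 0 \<or> ?M r' p = 0" using ax q'r'(1,2) unfolding is_axis_iff[OF p] by blast
    then show "?M q (f p) = 0 \<or> ?M r (f p) = 0" using q'r' meet_f p by metis
  qed
  \<comment> \<open>The radius \<open>1 / 2\<close> is an arbitrary choice of one probe on each
    positive half-axis. The image coordinate is \<open>1 / 2\<close> or \<open>- 1 / 2\<close>, so
    its double is a sign.\<close>
  have "\<exists>k d. f (axis i (1 / 2)) = axis k d \<and> \<bar>d\<bar> = 1 / 2" for i
  proof -
    have b: "axis i (1 / 2) \<in> (ball_T :: (real ^ 'n) set)" by (simp add: axis_ball)
    then obtain k d where "f (axis i (1 / 2)) = axis k d" using axis_f by blast
    then show ?thesis using norm_f[OF b] by auto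
  qed
  then obtain \<tau> c where tc: "\<And>i. f (axis i (1 / 2)) = axis (\<tau> i) (c i)" and c: "\<And>i. \<bar>c i\<bar> = 1 / 2" by metis
  \<comment> \<open>Two nonzero points on one half-axis have a nonzero meet, hence so do their
    images, which then share a half-axis; the norm determines the position on it.\<close>
  have same_ray: "f (axis i v) = axis k (2 * d * v)"
    if v: "0 < v * u" "\<bar>v\<bar> < 1" and u: "\<bar>u\<bar> = 1 / 2" "f (axis i u) = axis k (2 * d * u)" and d: "\<bar>d\<bar> = 1 / 2" for i k u v d
  proof -
    have b: "axis i v \<in> (ball_T :: (real ^ 'n) set)" "axis i u \<in> (ball_T :: (real ^ 'n) set)"
      using v(2) u(1) by (auto simp: axis_ball)
    obtain l e where le: "f (axis i v) = axis l e" using axis_f[OF b(1)] by blast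
    have "?M (axis i v) (axis i u) > 0"
      unfolding meet_T_axis using v(1) u(1) by (auto simp: min_def)
    then have "?M (axis l e) (axis k (2 * d * u)) > 0" using meet_f[OF b] le u(2) by simp
    then have "axis l e $ k * (2 * d * u) > 0" unfolding meet_T_axis by (auto split: if_splits)
    then have "l = k" "e * (d * u) > 0" by (auto simp: axis_def ac_simps split: if_splits)
    moreover have "\<bar>e\<bar> = \<bar>v\<bar>" using norm_f[OF b(1)] le by simp
    then have "e = v \<or> e = - v" by (simp only: abs_eq_iff)
    moreover have "d = 1 / 2 \<or> d = - 1 / 2" "u = 1 / 2 \<or> u = - 1 / 2" using d u(1) by linarith+
    ultimately have "e = 2 * d * v"
      using v(1) by (elim disjE; simp; linarith)
    then show ?thesis using le \<open>l = k\<close> by simp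
  qed
  \<comment> \<open>If the images of two opposite probes lay on different axes, some point would
    meet both images, and the \<open>i\<close>-th coordinate of its preimage would be positive and
    negative at once.\<close>
  have opp: "f (axis i (- 1 / 2)) = axis (\<tau> i) (- c i)" for i
  proof -
    let ?e = "axis i (1 / 2) :: real ^ 'n" and ?e' = "axis i (- 1 / 2) :: real ^ 'n"
    have b: "?e \<in> ball_T" "?e' \<in> ball_T" by (simp_all add: axis_ball)
    obtain k d where kd: "f ?e' = axis k d" using axis_f[OF b(2)] by blast
    have d: "\<bar>d\<bar> = 1 / 2" using norm_f[OF b(2)] kd by simp
    have "k = \<tau> i"
    proof (rule ccontr)
      assume "k \<noteq> \<tau> i"
      \<comment> \<open>Halving the two images gives their sum norm \<open>1 / 2\<close>, so that it
        stays in the ball.\<close>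
      define w where "w = axis (\<tau> i) (c i / 2) + axis k (d / 2)"
      have wk: "w $ \<tau> i = c i / 2" "w $ k = d / 2" using \<open>k \<noteq> \<tau> i\<close> by (auto simp: w_def axis_def)
      have "axis (\<tau> i) (c i / 2) $ k = 0" using \<open>k \<noteq> \<tau> i\<close> by (simp add: axis_def)
      then have "norm_T w = 1 / 2" unfolding w_def norm_T_add_axis using c[of i] d by simp
      then have "w \<in> ball_T" by (simp add: ball_T_def)
      then obtain u where u: "u \<in> ball_T" "f u = w" using surj by blast
      have "c i * c i > 0" "d * d > 0" using c[of i] d by (auto simp: zero_less_mult_iff abs_if split: if_splits)
      then have "?M w (axis (\<tau> i) (c i)) > 0" "?M w (axis k d) > 0"
        unfolding meet_T_axis wk using c[of i] d by (auto simp: min_def)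
      then have "?M u ?e > 0" "?M u ?e' > 0" using meet_f[OF u(1)] b u(2) tc kd by metis+
      then have "u $ i * (1 / 2) > 0" "u $ i * (- 1 / 2) > 0" unfolding meet_T_axis by (auto split: if_splits)
      then show False by simp
    qed
    moreover have "d \<noteq> c i"
    proof
      assume "d = c i"
      then have "?e = ?e'" using inj[of ?e ?e'] b tc kd \<open>k = \<tau> i\<close> by simp
      then show False by (simp add: axis_eq_axis)
    qed
    then have "d = - c i" using d c[of i] by linarith
    ultimately show ?thesis using kd by simp
  qed
  have ray: "f (axis i v) = axis (\<tau> i) (2 * c i * v)" if "\<bar>v\<bar> < 1" for i v
  proof (cases v "0 :: real" rule: linorder_cases)
    case less
    then show ?thesis using that same_ray[of v "- 1 / 2" i "\<tau> i" "c i"] opp c by (simp add: mult_neg_pos)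
  next
    case equal
    have "axis k (0 :: real) = 0" for k :: 'n by (simp add: vec_eq_iff axis_def)
    then show ?thesis using equal by (simp only: f0 mult_zero_right)
  next
    case greater
    then show ?thesis using that same_ray[of v "1 / 2" i "\<tau> i" "c i"] tc c by simp
  qed
  have comp: "f p $ \<tau> i = 2 * c i * p $ i" if p: "p \<in> ball_T" for p i
  proof (cases "p = 0")
    case True
    then show ?thesis using f0 by simp
  next
    case False
    \<comment> \<open>No coordinate of \<open>p\<close> or of \<open>f p\<close> exceeds
      \<open>t\<close> in modulus, so the meet with an axis point at radius \<open>t\<close> returns
      the coordinate itself. The two choices \<open>v = t\<close> and \<open>v = - t\<close> also
      reveal its sign.\<close>
    define t where "t = norm_T p"
    have "t > 0" using False norm_T_nonneg[of p] by (simp add: t_def less_le)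
    have "t < 1" using p by (simp add: t_def ball_T_def)
    have y: "\<bar>f p $ \<tau> i\<bar> \<le> t" "\<bar>p $ i\<bar> \<le> t"
      using component_le_norm_T[of "f p" "\<tau> i"] component_le_norm_T[of p i] by (simp_all add: norm_f[OF p] t_def)
    have "?M (f p) (axis (\<tau> i) (2 * c i * v)) = ?M p (axis i v)" if "\<bar>v\<bar> = t" for v
    proof -
      have "\<bar>v\<bar> < 1" using that \<open>t < 1\<close> by simp
      then show ?thesis using meet_f[OF p, of "axis i v"] ray[of v i] by (simp add: axis_ball)
    qed
    moreover have "\<bar>2 * c i * v\<bar> = t" if "\<bar>v\<bar> = t" for v using that c[of i] by (simp add: abs_mult)
    ultimately have eq: "(if f p $ \<tau> i * (2 * c i * v) > 0 then \<bar>f p $ \<tau> i\<bar> else 0) = (if p $ i * v > 0 then \<bar>p $ i\<bar> else 0)"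
      if "\<bar>v\<bar> = t" for v
      using that y unfolding meet_T_axis by (metis min.absorb1)
    have "c i = 1 / 2 \<or> c i = - 1 / 2" using c[of i] by linarith
    then show ?thesis
      using eq[of t] eq[of "- t"] \<open>t > 0\<close>
      by (auto simp: zero_less_mult_iff mult_less_0_iff abs_if split: if_splits)
  qed
  have "inj \<tau>"
  proof (rule injI)
    fix i j assume ij: "\<tau> i = \<tau> j"
    have "c j = c i \<or> c j = - c i" using c[of i] c[of j] by linarith
    then have "f (axis j (1 / 2)) = f (axis i (1 / 2)) \<or> f (axis j (1 / 2)) = f (axis i (- 1 / 2))"
      using tc[of i] tc[of j] opp[of i] ij by auto
    then have "axis j (1 / 2 :: real) = axis i (1 / 2) \<or> axis j (1 / 2 :: real) = axis i (- 1 / 2)"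
      using inj by (auto simp: axis_ball)
    then show "i = j" by (auto simp: axis_eq_axis)
  qed
  then have "bij \<tau>" by (simp add: bij_def finite_UNIV_inj_surj)
  \<comment> \<open>\<open>comp\<close> tells where coordinate \<open>i\<close> is sent, whereas
    \<open>signed_perm\<close> records where coordinate \<open>k\<close> comes from; hence the
    inverse of \<tau>.\<close>
  show thesis
  proof (rule that)
    have "2 * c i = - 1 \<or> 2 * c i = 1" for i using c[of i] by linarith
    then show "range (\<lambda>k. 2 * c (inv_into UNIV \<tau> k)) \<subseteq> {- 1, 1}" by auto
    show "bij (inv_into UNIV \<tau>)" using \<open>bij \<tau>\<close> by (rule bij_imp_bij_inv)
    show "f x = signed_perm (\<lambda>k. 2 * c (inv_into UNIV \<tau> k)) (inv_into UNIV \<tau>) x" if "x \<in> ball_T" for x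
      unfolding signed_perm_def vec_eq_iff
    proof
      fix k
      have "\<tau> (inv_into UNIV \<tau> k) = k" using \<open>bij \<tau>\<close> by (simp add: bij_is_surj surj_f_inv_f)
      then show "f x $ k = (\<chi> i. 2 * c (inv_into UNIV \<tau> i) * x $ inv_into UNIV \<tau> i) $ k"
        using comp[OF that, of "inv_into UNIV \<tau> k"] by simp
    qed
  qed
qed

section \<open>Signed permutations as isometries\<close>

lemma norm_T_signed_perm:
  assumes "range s \<subseteq> {- 1, 1}" "bij \<sigma>"
  shows "norm_T (signed_perm s \<sigma> x) = norm_T x"
proof -
  have "\<bar>s i\<bar> = 1" for i using sign_cases[OF assms(1), of i] by auto
  then have "norm_T (signed_perm s \<sigma> x) = (\<Sum>i\<in>UNIV. \<bar>x $ \<sigma> i\<bar>)"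
    by (simp add: norm_T_def signed_perm_def abs_mult)
  also have "\<dots> = norm_T x"
    unfolding norm_T_def by (rule sum.reindex_bij_betw[OF assms(2)])
  finally show ?thesis .
qed

lemma hyperoctahedral_norm_T:
  assumes "g \<in> carrier hyperoctahedral_group"
  shows "linear g" "norm_T (g x) = norm_T x"
  using assms linear_signed_perm norm_T_signed_perm by (auto simp: hyperoctahedral_group_def)

text \<open>By the distance formula \<open>dist_T x y\<close> depends only on the norms of
  \<open>x\<close>, \<open>y\<close> and \<open>x - y\<close>, and a linear map preserving
  \<open>norm_T\<close> keeps all three.\<close>

lemma hyperoctahedral_dist_T:
  assumes g: "g \<in> carrier hyperoctahedral_group" and "x \<in> ball_T" "y \<in> ball_T"
  shows "dist_T (g x) (g y) = dist_T x y"
proof -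
  have "g x \<in> ball_T" "g y \<in> ball_T" using assms hyperoctahedral_norm_T(2)[OF g] by (auto simp: ball_T_def)
  moreover have "norm_T (g x - g y) = norm_T (x - y)"
    using hyperoctahedral_norm_T[OF g] by (metis linear_diff)
  ultimately show ?thesis
    using assms by (simp add: dist_T_eq norm_T_meet_T_eq hyperoctahedral_norm_T(2)[OF g])
qed

lemma hyperoctahedral_bij_betw:
  fixes g :: "real ^ 'n \<Rightarrow> real ^ 'n"
  assumes g: "g \<in> carrier hyperoctahedral_group"
  shows "bij_betw g ball_T ball_T"
proof -
  interpret group "hyperoctahedral_group :: (real ^ 'n \<Rightarrow> real ^ 'n) monoid"
    by (rule group_hyperoctahedral_group)
  let ?h = "inv\<^bsub>hyperoctahedral_group\<^esub> g"
  have h: "?h \<in> carrier hyperoctahedral_group" using g by simp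
  have "g \<circ> ?h = id" "?h \<circ> g = id"
    using r_inv[OF g] l_inv[OF g] by (simp_all add: hyperoctahedral_group_def)
  then have "g (?h x) = x" "?h (g x) = x" for x by (metis comp_apply id_apply)+
  moreover have "g x \<in> ball_T" "?h x \<in> ball_T" if "x \<in> ball_T" for x
    using that hyperoctahedral_norm_T(2)[OF g] hyperoctahedral_norm_T(2)[OF h] by (auto simp: ball_T_def)
  ultimately show ?thesis by (intro bij_betw_byWitness[where f' = ?h]) auto
qed

theorem theorem3:
  assumes "CARD('n::finite) \<ge> 2"
  shows "isometry_group (ball_T :: (real ^ 'n) set) dist_T
           \<cong> (hyperoctahedral_group :: (real ^ 'n \<Rightarrow> real ^ 'n) monoid)"
proof -
  let ?B = "ball_T :: (real ^ 'n) set" and ?H = "hyperoctahedral_group :: (real ^ 'n \<Rightarrow> real ^ 'n) monoid"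
  \<comment> \<open>Members of the isometry group are extensional, so a signed permutation has to be
    cut down to the ball.\<close>
  let ?I = "isometry_group ?B dist_T" and ?\<Phi> = "\<lambda>g. restrict g ?B"
  have maps: "g x \<in> ?B" if "g \<in> carrier ?H" "x \<in> ?B" for g x
    using bij_betwE[OF hyperoctahedral_bij_betw[OF that(1)]] that(2) by blast
  have Bij: "?\<Phi> g \<in> Bij ?B" if "g \<in> carrier ?H" for g
    using hyperoctahedral_bij_betw[OF that] by (simp add: Bij_def)
  have in_I: "?\<Phi> g \<in> carrier ?I" if g: "g \<in> carrier ?H" for g
    using Bij[OF g] hyperoctahedral_dist_T[OF g] by (simp add: isometry_group_def)
  have "?\<Phi> \<in> hom ?H ?I"
  proof (rule homI)
    fix g h assume g: "g \<in> carrier ?H" and h: "h \<in> carrier ?H"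
    have "g \<otimes>\<^bsub>?H\<^esub> h = g \<circ> h" by (simp add: hyperoctahedral_group_def)
    moreover have "?\<Phi> g \<otimes>\<^bsub>?I\<^esub> ?\<Phi> h = compose ?B (?\<Phi> g) (?\<Phi> h)"
      using Bij g h by (simp add: isometry_group_def BijGroup_def)
    moreover have "?\<Phi> (g \<circ> h) = compose ?B (?\<Phi> g) (?\<Phi> h)"
      using maps[OF h] by (auto simp: compose_def fun_eq_iff)
    ultimately show "?\<Phi> (g \<otimes>\<^bsub>?H\<^esub> h) = ?\<Phi> g \<otimes>\<^bsub>?I\<^esub> ?\<Phi> h" by simp
  qed (rule in_I)
  moreover have "inj_on ?\<Phi> (carrier ?H)"
  proof (rule inj_onI)
    fix g h assume g: "g \<in> carrier ?H" and h: "h \<in> carrier ?H" and eq: "?\<Phi> g = ?\<Phi> h"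
    have "g x = h x" for x
    proof -
      \<comment> \<open>The factor scales \<open>x\<close> into the ball; by linearity, agreement
        there gives agreement at \<open>x\<close>.\<close>
      define r where "r = 1 / (norm_T x + 1)"
      have "r > 0" "r * norm_T x < 1" using norm_T_nonneg[of x] by (auto simp: r_def field_simps add_pos_nonneg)
      then have "r *\<^sub>R x \<in> ?B" by (simp add: ball_T_def norm_T_scaleR)
      then have "g (r *\<^sub>R x) = h (r *\<^sub>R x)" using fun_cong[OF eq, of "r *\<^sub>R x"] by simp
      then have "r *\<^sub>R g x = r *\<^sub>R h x"
        using hyperoctahedral_norm_T(1)[OF g] hyperoctahedral_norm_T(1)[OF h] by (simp add: linear_scale)
      then show ?thesis using \<open>r > 0\<close> by simp
    qed
    then show "g = h" by blast
  qed
  moreover have "carrier ?I \<subseteq> ?\<Phi> ` carrier ?H"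
  proof
    fix f assume "f \<in> carrier ?I"
    then have f: "f \<in> Bij ?B" "\<And>x y. \<lbrakk>x \<in> ?B; y \<in> ?B\<rbrakk> \<Longrightarrow> dist_T (f x) (f y) = dist_T x y"
      by (auto simp: isometry_group_def)
    then have "bij_betw f ?B ?B" "f \<in> extensional ?B" by (auto simp: Bij_def)
    then obtain s \<sigma> where s: "range s \<subseteq> {- 1, 1}" "bij \<sigma>" "\<And>x. x \<in> ?B \<Longrightarrow> f x = signed_perm s \<sigma> x"
      using isometry_is_signed_perm[OF assms _ f(2)] by blast
    have "f = ?\<Phi> (signed_perm s \<sigma>)"
      using s(3) \<open>f \<in> extensional ?B\<close> by (auto simp: fun_eq_iff extensional_def)
    moreover have "signed_perm s \<sigma> \<in> carrier ?H" using s(1,2) by (auto simp: hyperoctahedral_group_def)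
    ultimately show "f \<in> ?\<Phi> ` carrier ?H" by blast
  qed
  ultimately have "?\<Phi> \<in> iso ?H ?I" using in_I by (auto simp: iso_def bij_betw_def)
  then show ?thesis
    using group.iso_sym[OF group_hyperoctahedral_group] unfolding is_iso_def by blast
qed

end
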